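(* Let $N\ge 1$ be an integer (polynomial degree). Consider the linear advection equation $\partial_t u+\partial_x u=0$ for $x\in(0,2\pi)$, $t>0$, with periodic boundary conditions and initial datum $u(x,0)=e^{\mathrm{i}\kappa x}$, $\kappa\in\mathbb{N}$. Consider on $[0,2\pi]$ a uniform fixed (Eulerian) grid of $N_e>0$ elements of size $\Delta x=2\pi/N_e$, and the Rusanov-type numerical flux. Then the implicit ADER-DG method of degree $N$ (described in the context), applied to this problem, is (von Neumann) stable for any time step $\Delta t>0$: for every $\Delta t>0$ the amplification matrix $A_N(\Delta t/\Delta x,\theta)\in\mathbb{C}^{(N+1)\times(N+1)}$ of the method at the phase angle $\theta=\kappa\Delta x$ has spectral radius $\rho\big(A_N(\Delta t/\Delta x,\theta)\big)\le 1$.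
   Context: **Grid.** $x_{i+1/2}=i\,\Delta x$ for $i=0,\dots,N_e$, $\Omega_i=[x_{i-1/2},x_{i+1/2}]$ for $i=1,\dots,N_e$, with element indices understood modulo $N_e$ (periodicity). $t^n=n\Delta t$ and $C_i^n=\Omega_i\times[t^n,t^{n+1}]$. **Discrete spaces.** At time $t^n$ the approximate solution on $\Omega_i$ is a polynomial $u_i^n$ in $x$ of degree at most $N$ with complex coefficients, $u_i^n(x)=\sum_{\ell=0}^N \phi_{i,\ell}(x)\,\hat u^n_{i,\ell}$, where $\phi_{i,\ell}(x)=\big((x-b_i)/\Delta x\big)^\ell$ and $b_i=(x_{i-1/2}+x_{i+1/2})/2$. Write $\hat u_i^n=(\hat u^n_{i,0},\dots,\hat u^n_{i,N})\in\mathbb{C}^{N+1}$. On $C_i^n$ one uses the space $\mathcal{P}_N(C_i^n)$ of polynomials in $(x,t)$ of total degree at most $N$ (of dimension $(N+1)(N+2)/2$), spanned by $\big((x-b_i)/\Delta x\big)^{\ell_1}\big((t-t^n)/\Delta t\big)^{\ell_2}$ with $\ell_1,\ell_2\ge 0$, $\ell_1+\ell_2\le N$. **Rusanov-type flux.** For interior value $q^-$, exterior value $q^+$, outward unit normal $(\hat n_x,\hat n_t)$ and $f(q)=q$: $\mathcal F(q^-,q^+,\hat n)=\tfrac12(q^++q^-)\hat n_x+\tfrac12(q^++q^-)\hat n_t-\tfrac12 s_{\max}(q^+-q^-)$, with $s_{\max}=|1-v|\,|\hat n_x|$ and $v$ the grid velocity. On the fixed grid $v=0$ and $\hat n_t=0$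 on lateral faces, so $\mathcal F$ is the upwind flux: it equals $q^-$ on the right face ($\hat n_x=1$) and $-q^+$ on the left face ($\hat n_x=-1$). **Implicit ADER-DG step.** Given $\{u_i^n\}_i$, find simultaneously for all $i$ the functions $q_i^n\in\mathcal{P}_N(C_i^n)$ (complex coefficients) such that for all $i$ and all $\vartheta\in\mathcal{P}_N(C_i^n)$ $$\int_{\Omega_i}\vartheta(x,t^{n+1})q_i^n(x,t^{n+1})\,dx-\int_{C_i^n}(\partial_t\vartheta+\partial_x\vartheta)\,q_i^n\,dx\,dt+\int_{t^n}^{t^{n+1}}\vartheta(x_{i+1/2},t)\,q_i^n(x_{i+1/2},t)\,dt$$ $$-\int_{t^n}^{t^{n+1}}\vartheta(x_{i-1/2},t)\,q_{i-1}^n(x_{i-1/2},t)\,dt=\int_{\Omega_i}\vartheta(x,t^n)\,u_i^n(x)\,dx ,$$ where for $i=1$ the left neighbour is the element $N_e$ and its trace is taken at its right endpoint. Then $u_i^{n+1}$ is the $L^2(\Omega_i)$-projection of $q_i^n(\cdot,t^{n+1})$ onto polynomials of degree at most $N$, i.e. $u_i^{n+1}=q_i^n(\cdot,t^{n+1})$. **Amplification matrix and von Neumann stability.** For the initial datum $e^{\mathrm{i}\kappa x}$, setting $\theta=\kappa\Delta x$, the discrete solution satisfies $\hat u_{i-1}^n=e^{-\mathrm{i}\theta}\hat u_i^n$, and correspondingly the coefficients of $q_{i-1}^n$ (in its local basis) are $e^{-\mathrm{i}\theta}$ times those of $q_i^n$ (in its local basis). Substituting this relation, the step above reduces to a linear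 problem on one element, and it takes the form $\hat u_i^{n+1}=A_N(\Delta t/\Delta x,\theta)\,\hat u_i^n$. This defines the amplification matrix $A_N(\Delta t/\Delta x,\theta)$, which depends only on $N$, $\Delta t/\Delta x$ and $\theta$. The method is von Neumann stable if $\rho(A_N(\Delta t/\Delta x,\theta))\le 1$, where $\rho$ denotes the spectral radius. *)

theory Defs
  imports "HOL-Analysis.Analysis" "Jordan_Normal_Form.Spectral_Radius"
begin

text \<open>
  Periodic grid on \<open>[0, 2\<pi>]\<close> with elements \<open>1, \<dots>, Ne\<close>; the time levels are \<open>t\<^sup>n = n dt\<close>.
\<close>

definition mesh :: "nat \<Rightarrow> real" where
  "mesh Ne = 2 * pi / real Ne"

definition cell_left :: "real \<Rightarrow> nat \<Rightarrow> real" where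
  "cell_left dx i = (real i - 1) * dx"

definition cell_right :: "real \<Rightarrow> nat \<Rightarrow> real" where
  "cell_right dx i = real i * dx"

definition cell_centre :: "real \<Rightarrow> nat \<Rightarrow> real" where
  "cell_centre dx i = (cell_left dx i + cell_right dx i) / 2"

definition time_level :: "real \<Rightarrow> nat \<Rightarrow> real" where
  "time_level dt n = real n * dt"

definition left_nb :: "nat \<Rightarrow> nat \<Rightarrow> nat" where
  "left_nb Ne i = (if i = 1 then Ne else i - 1)"

definition right_nb :: "nat \<Rightarrow> nat \<Rightarrow> nat" where
  "right_nb Ne i = (if i = Ne then 1 else i + 1)"


text \<open>
  Polynomials on an element and on a space-time control volume, given by their coefficients in
  the local bases.  Polynomials are functions on the whole line (plane); only their values on the
  element (control volume) are ever used.
\<close>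

definition space_poly :: "nat \<Rightarrow> real \<Rightarrow> nat \<Rightarrow> complex Matrix.vec \<Rightarrow> real \<Rightarrow> complex" where
  "space_poly N dx i v x =
     (\<Sum>l\<le>N. vec_index v l * complex_of_real (((x - cell_centre dx i) / dx) ^ l))"

definition space_polys :: "nat \<Rightarrow> real \<Rightarrow> nat \<Rightarrow> (real \<Rightarrow> complex) set" where
  "space_polys N dx i = space_poly N dx i ` carrier_vec (N + 1)"

definition st_poly ::
  "nat \<Rightarrow> real \<Rightarrow> real \<Rightarrow> nat \<Rightarrow> nat \<Rightarrow> (nat \<Rightarrow> nat \<Rightarrow> complex) \<Rightarrow> real \<Rightarrow> real \<Rightarrow> complex" where
  "st_poly N dx dt i n c x t =
     (\<Sum>(l1, l2) \<in> {(l1, l2). l1 + l2 \<le> N}.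
        c l1 l2 * complex_of_real
          (((x - cell_centre dx i) / dx) ^ l1 * ((t - time_level dt n) / dt) ^ l2))"

definition st_polys ::
  "nat \<Rightarrow> real \<Rightarrow> real \<Rightarrow> nat \<Rightarrow> nat \<Rightarrow> (real \<Rightarrow> real \<Rightarrow> complex) set" where
  "st_polys N dx dt i n = range (st_poly N dx dt i n)"


text \<open>
  Rusanov-type flux for \<open>f(q) = q\<close> with grid velocity \<open>v\<close>, interior value \<open>qm\<close>, exterior value
  \<open>qp\<close> and outward unit normal \<open>(nx, nt)\<close>.
\<close>

definition rusanov_flux ::
  "real \<Rightarrow> complex \<Rightarrow> complex \<Rightarrow> real \<times> real \<Rightarrow> complex" where
  "rusanov_flux v qm qp nrm =
     (case nrm of (nx, nt) \<Rightarrow>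
       (qp + qm) / 2 * complex_of_real nx + (qp + qm) / 2 * complex_of_real nt
         - complex_of_real (\<bar>1 - v\<bar> * \<bar>nx\<bar>) / 2 * (qp - qm))"

lemma rusanov_flux_right: "rusanov_flux 0 qm qp (1, 0) = qm"
  by (simp add: rusanov_flux_def field_simps)

lemma rusanov_flux_left: "rusanov_flux 0 qm qp (-1, 0) = - qp"
  by (simp add: rusanov_flux_def field_simps)


text \<open>
  Weak space-time formulation on one control volume, tested with \<open>\<psi>\<close>: \<open>u\<close> is the datum at the
  lower time level, \<open>qL\<close> and \<open>qR\<close> are the exterior traces at the left and right face.
\<close>

definition weak_form ::
  "real \<Rightarrow> real \<Rightarrow> nat \<Rightarrow> nat \<Rightarrow> (real \<Rightarrow> complex) \<Rightarrow> (real \<Rightarrow> real \<Rightarrow> complex) \<Rightarrow>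
   (real \<Rightarrow> complex) \<Rightarrow> (real \<Rightarrow> complex) \<Rightarrow> (real \<Rightarrow> real \<Rightarrow> complex) \<Rightarrow> bool" where
  "weak_form dx dt i n u q qL qR \<psi> \<longleftrightarrow>
     (let a = cell_left dx i; b = cell_right dx i;
          s = time_level dt n; s' = time_level dt (n + 1)
      in integral {a..b} (\<lambda>x. \<psi> x s' * q x s')
         - integral ({a..b} \<times> {s..s'})
             (\<lambda>(x, t). (vector_derivative (\<lambda>\<tau>. \<psi> x \<tau>) (at t)
                        + vector_derivative (\<lambda>\<xi>. \<psi> \<xi> t) (at x)) * q x t)
         + integral {s..s'} (\<lambda>t. \<psi> b t * rusanov_flux 0 (q b t) (qR t) (1, 0))
         + integral {s..s'} (\<lambda>t. \<psi> a t * rusanov_flux 0 (q a t) (qL t) (-1, 0))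
         = integral {a..b} (\<lambda>x. \<psi> x s * u x))"

definition is_L2_projection ::
  "nat \<Rightarrow> real \<Rightarrow> nat \<Rightarrow> (real \<Rightarrow> complex) \<Rightarrow> (real \<Rightarrow> complex) \<Rightarrow> bool" where
  "is_L2_projection N dx i g w \<longleftrightarrow>
     w \<in> space_polys N dx i \<and>
     (\<forall>\<phi> \<in> space_polys N dx i.
        integral {cell_left dx i..cell_right dx i} (\<lambda>x. \<phi> x * w x) =
        integral {cell_left dx i..cell_right dx i} (\<lambda>x. \<phi> x * g x))"


text \<open>
  One step of the implicit ADER-DG method from \<open>t\<^sup>n\<close> to \<open>t\<^sup>n\<^sup>+\<^sup>1\<close> on the whole periodic grid.  \<open>U i\<close> and
  \<open>U' i\<close> are the coefficient vectors of the solution on element \<open>i\<close> at the two time levels, \<open>c i\<close>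
  are the coefficients of the space-time polynomial on the control volume over element \<open>i\<close>.  The
  trace of a periodic neighbour is taken at the neighbour's own endpoint.
\<close>

definition ader_dg_step ::
  "nat \<Rightarrow> nat \<Rightarrow> real \<Rightarrow> nat \<Rightarrow> (nat \<Rightarrow> complex Matrix.vec) \<Rightarrow> (nat \<Rightarrow> nat \<Rightarrow> nat \<Rightarrow> complex) \<Rightarrow>
   (nat \<Rightarrow> complex Matrix.vec) \<Rightarrow> bool" where
  "ader_dg_step N Ne dt n U c U' \<longleftrightarrow>
     (let dx = mesh Ne; q = (\<lambda>i. st_poly N dx dt i n (c i)) in
      \<forall>i \<in> {1..Ne}.
        U i \<in> carrier_vec (N + 1) \<and> U' i \<in> carrier_vec (N + 1) \<and>
        (\<forall>\<psi> \<in> st_polys N dx dt i n.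
           weak_form dx dt i n (space_poly N dx i (U i)) (q i)
             (\<lambda>t. q (left_nb Ne i) (cell_right dx (left_nb Ne i)) t)
             (\<lambda>t. q (right_nb Ne i) (cell_left dx (right_nb Ne i)) t) \<psi>) \<and>
        is_L2_projection N dx i (\<lambda>x. q i x (time_level dt (n + 1))) (space_poly N dx i (U' i)))"


text \<open>
  The step restricted to a Fourier mode of phase angle \<open>\<theta>\<close>: the coefficients on the left neighbour
  are \<open>e\<^sup>-\<^sup>i\<^sup>\<theta>\<close> times those on the element.  The relation holds between the coefficient vectors \<open>v\<close>,
  \<open>v'\<close> on the element \<open>i\<close> before and after the step.
\<close>

definition mode_step ::
  "nat \<Rightarrow> nat \<Rightarrow> real \<Rightarrow> real \<Rightarrow> nat \<Rightarrow> nat \<Rightarrow> complex Matrix.vec \<Rightarrow> complex Matrix.vec \<Rightarrow> bool" where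
  "mode_step N Ne dt \<theta> n i v v' \<longleftrightarrow>
     (\<exists>U c U'.
        ader_dg_step N Ne dt n U c U' \<and>
        (\<forall>j \<in> {1..Ne}. U (left_nb Ne j) = exp (- (\<i> * complex_of_real \<theta>)) \<cdot>\<^sub>v U j) \<and>
        (\<forall>j \<in> {1..Ne}. \<forall>l1 l2. l1 + l2 \<le> N \<longrightarrow>
           c (left_nb Ne j) l1 l2 = exp (- (\<i> * complex_of_real \<theta>)) * c j l1 l2) \<and>
        U i = v \<and> U' i = v')"

text \<open>
  The amplification matrix depends on the degree, the ratio \<open>r\<close> of time step and mesh size, and
  \<open>\<theta>\<close> only: one matrix serves every grid, wave number, time step, time level and element with these
  values of \<open>r\<close> and \<open>\<theta>\<close>.  By the equivalence, the update \<open>v'\<close> exists and is unique for every \<open>v\<close>.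
\<close>

definition is_amplification_matrix :: "nat \<Rightarrow> real \<Rightarrow> real \<Rightarrow> complex mat \<Rightarrow> bool" where
  "is_amplification_matrix N r \<theta> A \<longleftrightarrow>
     A \<in> carrier_mat (N + 1) (N + 1) \<and>
     (\<forall>(Ne::nat) (\<kappa>::nat) (dt::real) (n::nat) (i::nat).
        Ne > 0 \<longrightarrow> dt > 0 \<longrightarrow> dt / mesh Ne = r \<longrightarrow> real \<kappa> * mesh Ne = \<theta> \<longrightarrow> i \<in> {1..Ne} \<longrightarrow>
        (\<forall>v \<in> carrier_vec (N + 1). \<forall>v'. mode_step N Ne dt \<theta> n i v v' \<longleftrightarrow> v' = A *\<^sub>v v))"

definition amplification_matrix :: "nat \<Rightarrow> real \<Rightarrow> real \<Rightarrow> complex mat" where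
  "amplification_matrix N r \<theta> = (THE A. is_amplification_matrix N r \<theta> A)"

definition von_neumann_stable :: "nat \<Rightarrow> real \<Rightarrow> real \<Rightarrow> bool" where
  "von_neumann_stable N r \<theta> \<longleftrightarrow> spectral_radius (amplification_matrix N r \<theta>) \<le> 1"

end

theory Submission
  imports Defs
begin

text \<open>
  After rescaling to the reference element \<open>[-1/2, 1/2] \<times> [0, 1]\<close>, with \<open>r = dt / dx\<close> and
  \<open>z = exp (-\<i> \<theta>)\<close>, the step for one Fourier mode is a linear problem for a polynomial \<open>q\<close> of total
  degree at most \<open>N\<close>.  Testing it with the conjugate of \<open>q\<close>, taking real parts and integrating by
  parts gives, because \<open>\<bar>z\<bar> = 1\<close>, the energy identity
  \<open>\<parallel>q(\<cdot>, 1)\<parallel>\<^sup>2 + \<parallel>q(\<cdot>, 0) - u\<parallel>\<^sup>2 + r \<parallel>q(-1/2, \<cdot>) - z q(1/2, \<cdot>)\<parallel>\<^sup>2 = \<parallel>u\<parallel>\<^sup>2\<close> in \<open>L\<^sup>2\<close>.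
  For \<open>u = 0\<close> it leaves \<open>q(\<cdot>, 0) = 0\<close> and no jump, and then testing with the conjugate of
  \<open>q\<^sub>t + r q\<^sub>x\<close> shows that \<open>q\<close> solves the transport equation, hence vanishes: the linear problem is
  uniquely solvable.  In general the identity says that \<open>u \<mapsto> q(\<cdot>, 1)\<close> is an \<open>L\<^sup>2\<close> contraction, so
  its eigenvalues lie in the closed unit disc.
\<close>

subsection \<open>Integrals, polynomials and linear systems\<close>

text \<open>Brings the weak problem into matrix form. No conjugates occur because the weak
  formulation is bilinear; boxes \<open>cbox a b\<close> cover intervals and the space-time
  rectangle alike.\<close>

lemma integral_sum_mult_sum:
  fixes f :: "'i \<Rightarrow> 'a::euclidean_space \<Rightarrow> complex" and g :: "'j \<Rightarrow> 'a \<Rightarrow> complex"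
  assumes "finite I" "finite J"
    and "\<And>i. i \<in> I \<Longrightarrow> continuous_on (cbox a b) (f i)"
    and "\<And>j. j \<in> J \<Longrightarrow> continuous_on (cbox a b) (g j)"
  shows "integral (cbox a b) (\<lambda>x. (\<Sum>i\<in>I. d i * f i x) * (\<Sum>j\<in>J. c j * g j x)) =
    (\<Sum>i\<in>I. d i * (\<Sum>j\<in>J. integral (cbox a b) (\<lambda>x. f i x * g j x) * c j))"
proof -
  have int: "(\<lambda>x. f i x * g j x) integrable_on cbox a b" if "i \<in> I" "j \<in> J" for i j
    using assms that by (intro integrable_continuous continuous_intros) auto
  have "integral (cbox a b) (\<lambda>x. (\<Sum>i\<in>I. d i * f i x) * (\<Sum>j\<in>J. c j * g j x)) =
    integral (cbox a b) (\<lambda>x. \<Sum>i\<in>I. \<Sum>j\<in>J. (d i * c j) * (f i x * g j x))"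
    unfolding sum_product by (simp add: mult_ac)
  also have "\<dots> = (\<Sum>i\<in>I. integral (cbox a b) (\<lambda>x. \<Sum>j\<in>J. (d i * c j) * (f i x * g j x)))"
    using assms int by (intro integral_sum integrable_sum integrable_on_mult_right) auto
  also have "\<dots> = (\<Sum>i\<in>I. \<Sum>j\<in>J. integral (cbox a b) (\<lambda>x. (d i * c j) * (f i x * g j x)))"
    using assms int by (intro sum.cong refl integral_sum integrable_on_mult_right) auto
  also have "\<dots> = (\<Sum>i\<in>I. d i * (\<Sum>j\<in>J. integral (cbox a b) (\<lambda>x. f i x * g j x) * c j))"
    by (simp add: sum_distrib_left mult_ac)
  finally show ?thesis .
qed

text \<open>Substitution \<open>x = m + h * y\<close>. The endpoints enter through equations so that
  \<open>cell_bounds\<close> fits directly, for a cell (\<open>h = dx\<close>) as for a time slab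
  (\<open>h = dt\<close>).\<close>

lemma integral_affine:
  fixes f :: "real \<Rightarrow> complex"
  assumes "h > 0" "continuous_on {p..q} f" "a = m + h * p" "b = m + h * q"
  shows "integral {a..b} (\<lambda>x. f ((x - m) / h)) = of_real h * integral {p..q} f"
proof -
  have "(f has_integral integral {p..q} f) (cbox p q)"
    using assms(2) by (simp add: integrable_continuous_interval integrable_integral)
  from has_integral_affinity'[OF this, of "1 / h" "- m / h"] \<open>h > 0\<close>
  have *: "((\<lambda>x. f ((1 / h) *\<^sub>R x + - m / h)) has_integral (h *\<^sub>R integral {p..q} f))
      (cbox ((p - - m / h) /\<^sub>R (1 / h)) ((q - - m / h) /\<^sub>R (1 / h)))"
    by simp
  have "(p - - m / h) /\<^sub>R (1 / h) = a" "(q - - m / h) /\<^sub>R (1 / h) = b"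
    using assms by (simp_all add: field_simps)
  moreover have "(1 / h) *\<^sub>R x + - m / h = (x - m) / h" for x
    by (simp add: diff_divide_distrib)
  ultimately have "((\<lambda>x. f ((x - m) / h)) has_integral (h *\<^sub>R integral {p..q} f)) {a..b}"
    using * by (simp only: cbox_interval)
  then show ?thesis
    by (simp add: integral_unique scaleR_conv_of_real)
qed

lemma integral_rectangle:
  fixes f :: "real \<times> real \<Rightarrow> complex"
  assumes "continuous_on ({a..b} \<times> {c..d}) f"
  shows "integral ({a..b} \<times> {c..d}) f = integral {a..b} (\<lambda>x. integral {c..d} (\<lambda>t. f (x, t)))"
proof -
  have "{a..b} \<times> {c..d} = cbox (a, c) (b, d)"
    by (simp add: cbox_Pair_eq del: cbox_interval)
  with integral_prod_continuous[of a c b d f] assms show ?thesis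
    by (simp only: cbox_interval)
qed

lemma integral_affine_rectangle:
  fixes f :: "real \<times> real \<Rightarrow> complex"
  assumes h: "h > 0" "k > 0" and cont: "continuous_on UNIV f"
    and ab: "a = m + h * p" "b = m + h * q" and cd: "c = l + k * p'" "d = l + k * q'"
  shows "integral ({a..b} \<times> {c..d}) (\<lambda>(x, t). f ((x - m) / h, (t - l) / k)) =
    of_real (h * k) * integral ({p..q} \<times> {p'..q'}) f"
proof -
  have cf: "continuous_on A f" for A
    using cont continuous_on_subset by blast
  have "integral ({a..b} \<times> {c..d}) (\<lambda>(x, t). f ((x - m) / h, (t - l) / k)) =
    integral {a..b} (\<lambda>x. integral {c..d} (\<lambda>t. f ((x - m) / h, (t - l) / k)))"
    unfolding case_prod_beta
    by (subst integral_rectangle)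
      (use h in \<open>auto intro!: continuous_intros continuous_on_compose2[OF cont]\<close>)
  also have "\<dots> = integral {a..b}
      (\<lambda>x. of_real k * integral {p'..q'} (\<lambda>t. f ((x - m) / h, t)))"
    using h cd by (subst integral_affine[where p = p' and q = q'])
      (auto intro!: continuous_intros continuous_on_compose2[OF cont])
  also have "\<dots> = of_real k * integral {a..b} (\<lambda>x. integral {p'..q'} (\<lambda>t. f ((x - m) / h, t)))"
    by simp
  also have "integral {a..b} (\<lambda>x. integral {p'..q'} (\<lambda>t. f ((x - m) / h, t))) =
      of_real h * integral {p..q} (\<lambda>x. integral {p'..q'} (\<lambda>t. f (x, t)))"
  proof (rule integral_affine[OF h(1) _ ab])
    \<comment> \<open>The outer substitution needs the inner integral to depend continuously on
      \<open>x\<close>.\<close>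
    show "continuous_on {p..q} (\<lambda>x. integral {p'..q'} (\<lambda>t. f (x, t)))"
      using integral_continuous_on_param[of "{p..q}" p' q' "\<lambda>x t. f (x, t)"] cf
      by (simp add: case_prod_beta)
  qed
  also have "integral {p..q} (\<lambda>x. integral {p'..q'} (\<lambda>t. f (x, t))) =
      integral ({p..q} \<times> {p'..q'}) f"
    by (simp add: integral_rectangle cf)
  finally show ?thesis by simp
qed

lemma integral_rectangle_deriv_snd:
  fixes F F' :: "real \<Rightarrow> real \<Rightarrow> complex"
  assumes "c \<le> d"
    and "\<And>x t. ((\<lambda>t. F x t) has_vector_derivative F' x t) (at t)"
    and "continuous_on UNIV (\<lambda>p. F' (fst p) (snd p))"
  shows "integral ({a..b} \<times> {c..d}) (\<lambda>p. F' (fst p) (snd p)) =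
    integral {a..b} (\<lambda>x. F x d - F x c)"
proof -
  have "integral ({a..b} \<times> {c..d}) (\<lambda>p. F' (fst p) (snd p)) =
      integral {a..b} (\<lambda>x. integral {c..d} (F' x))"
    by (subst integral_rectangle) (use assms(3) continuous_on_subset in auto)
  also have "(\<lambda>x. integral {c..d} (F' x)) = (\<lambda>x. F x d - F x c)"
    by (intro ext integral_unique fundamental_theorem_of_calculus assms
        has_vector_derivative_at_within)
  finally show ?thesis by simp
qed

text \<open>The order of integration is exchanged first, so that the fundamental theorem applies to
  the inner integral in \<open>x\<close>.\<close>

lemma integral_rectangle_deriv_fst:
  fixes F F' :: "real \<Rightarrow> real \<Rightarrow> complex"
  assumes "a \<le> b"
    and "\<And>x t. ((\<lambda>x. F x t) has_vector_derivative F' x t) (at x)"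
    and "continuous_on UNIV (\<lambda>p. F' (fst p) (snd p))"
  shows "integral ({a..b} \<times> {c..d}) (\<lambda>p. F' (fst p) (snd p)) =
    integral {c..d} (\<lambda>t. F b t - F a t)"
proof -
  have "integral ({a..b} \<times> {c..d}) (\<lambda>p. F' (fst p) (snd p)) =
      integral {a..b} (\<lambda>x. integral {c..d} (\<lambda>t. F' x t))"
    by (subst integral_rectangle) (use assms(3) continuous_on_subset in auto)
  also have "\<dots> = integral {c..d} (\<lambda>t. integral {a..b} (\<lambda>x. F' x t))"
    using integral_swap_continuous[of a c b d F'] assms(3) continuous_on_subset
    by (fastforce simp: case_prod_beta)
  also have "(\<lambda>t. integral {a..b} (\<lambda>x. F' x t)) = (\<lambda>t. F b t - F a t)"
    by (intro ext integral_unique fundamental_theorem_of_calculus assms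
        has_vector_derivative_at_within)
  finally show ?thesis by simp
qed

lemma integral_cmod_power2:
  fixes f :: "'a::euclidean_space \<Rightarrow> complex"
  assumes "continuous_on (cbox a b) f"
  shows "complex_of_real (integral (cbox a b) (\<lambda>x. (cmod (f x))\<^sup>2)) =
    integral (cbox a b) (\<lambda>x. f x * cnj (f x))"
proof -
  have "(\<lambda>x. (cmod (f x))\<^sup>2) integrable_on cbox a b"
    using assms by (intro integrable_continuous continuous_intros)
  from has_integral_of_real[OF integrable_integral[OF this], where 'b = complex]
  show ?thesis
    by (simp add: complex_norm_square integral_unique flip: of_real_power)
qed

text \<open>A nonzero polynomial has finitely many complex roots, whereas a nondegenerate real
  interval embeds in the complex plane as an infinite set.\<close>

lemma polyfun_zero_on_interval:
  fixes c :: "nat \<Rightarrow> complex"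
  assumes "a < b" and "\<And>x. x \<in> {a..b} \<Longrightarrow> (\<Sum>l\<le>N. c l * of_real (x ^ l)) = 0" and "l \<le> N"
  shows "c l = 0"
proof (rule ccontr)
  assume "c l \<noteq> 0"
  then have "finite {z. (\<Sum>i\<le>N. c i * z ^ i) = 0}"
    using polyfun_finite_roots[of c N] assms(3) by blast
  then have "finite (complex_of_real ` {a..b})"
    by (rule finite_subset[rotated]) (use assms(2) in auto)
  then have "finite {a..b}"
    by (rule finite_imageD) (simp add: inj_on_def)
  then show False
    using assms(1) by (simp add: infinite_Icc)
qed

text \<open>An injective square system over a field is invertible, and \<open>R\<close> is the
  inverse matrix. The equivalence packages existence, uniqueness and linear dependence on the
  data.\<close>

lemma finite_linear_system_solvable:
  fixes M :: "'i \<Rightarrow> 'i \<Rightarrow> 'a::field"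
  assumes fin: "finite I"
    and inj: "\<And>c k. (\<And>j. j \<in> I \<Longrightarrow> (\<Sum>k\<in>I. M j k * c k) = 0) \<Longrightarrow> k \<in> I \<Longrightarrow> c k = 0"
  obtains R where "\<And>g c. (\<forall>j\<in>I. (\<Sum>k\<in>I. M j k * c k) = g j) \<longleftrightarrow>
    (\<forall>k\<in>I. c k = (\<Sum>j\<in>I. R k j * g j))"
proof -
  define m where "m = card I"
  \<comment> \<open>Matrices are indexed by initial segments of the naturals, so \<open>I\<close> is
    enumerated by \<open>e\<close>; \<open>e'\<close> is the inverse enumeration.\<close>
  obtain e where e: "bij_betw e {..<m} I"
    unfolding m_def using ex_bij_betw_nat_finite[OF fin] by (auto simp: atLeast0LessThan)
  define e' where "e' = the_inv_into {..<m} e"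
  have e': "e' k < m" "e (e' k) = k" if "k \<in> I" for k
    using that e unfolding e'_def bij_betw_def
    by (auto simp: the_inv_into_f_f)
  have e'e: "e' (e p) = p" if "p < m" for p
    using that e unfolding e'_def bij_betw_def by (simp add: the_inv_into_f_f)
  have eI: "e p \<in> I" if "p < m" for p
    using that e by (auto simp: bij_betw_def)
  have sumI: "(\<Sum>k\<in>I. f k) = (\<Sum>p<m. f (e p))" for f :: "'i \<Rightarrow> 'a"
    using sum.reindex_bij_betw[OF e] by metis
  define B where "B = Matrix.mat m m (\<lambda>(p, q). M (e p) (e q))"
  have B: "B \<in> carrier_mat m m" by (simp add: B_def)
  have Bv: "(\<forall>j\<in>I. (\<Sum>k\<in>I. M j k * c k) = g j) \<longleftrightarrow>
      B *\<^sub>v Matrix.vec m (c \<circ> e) = Matrix.vec m (g \<circ> e)" for c g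
  proof -
    have "B *\<^sub>v Matrix.vec m (c \<circ> e) = Matrix.vec m (g \<circ> e) \<longleftrightarrow>
        (\<forall>p<m. (\<Sum>q<m. M (e p) (e q) * c (e q)) = g (e p))"
      unfolding B_def vec_eq_iff by (simp add: scalar_prod_def atLeast0LessThan cong: sum.cong_simp)
    also have "\<dots> \<longleftrightarrow> (\<forall>j\<in>I. (\<Sum>q<m. M j (e q) * c (e q)) = g j)"
      using e' eI by metis
    finally show ?thesis by (simp add: sumI)
  qed
  \<comment> \<open>A kernel vector of \<open>B\<close>, read as a function on \<open>I\<close>
    through \<open>e'\<close>, would contradict injectivity.\<close>
  have "det B \<noteq> 0"
  proof
    assume "det B = 0"
    then obtain v where v: "v \<in> carrier_vec m" "v \<noteq> 0\<^sub>v m" "B *\<^sub>v v = 0\<^sub>v m"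
      using det_0_iff_vec_prod_zero_field[OF B] by blast
    have *: "Matrix.vec m ((\<lambda>k. vec_index v (e' k)) \<circ> e) = v"
      using v(1) e'e by (auto simp: vec_eq_iff)
    have "vec_index v (e' k) = 0" if "k \<in> I" for k
      using inj[of "\<lambda>k. vec_index v (e' k)" k] that Bv[of "\<lambda>k. vec_index v (e' k)" "\<lambda>_. 0"] * v(3)
      by (auto simp: zero_vec_def o_def)
    then have "v = 0\<^sub>v m"
      using v(1) e'e eI by (intro eq_vecI) (auto, metis)
    with v(2) show False ..
  qed
  then obtain C where C: "C \<in> carrier_mat m m" "C * B = 1\<^sub>m m" "B * C = 1\<^sub>m m"
    using det_non_zero_imp_unit[OF B, of undefined] by (auto simp: Units_def ring_mat_def)
  show thesis
  proof (rule that[of "\<lambda>k j. C $$ (e' k, e' j)"])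
    fix g c
    have "B *\<^sub>v Matrix.vec m (c \<circ> e) = Matrix.vec m (g \<circ> e) \<longleftrightarrow>
        Matrix.vec m (c \<circ> e) = C *\<^sub>v Matrix.vec m (g \<circ> e)"
      using C B by (metis assoc_mult_mat_vec one_mult_mat_vec vec_carrier)
    also have "\<dots> \<longleftrightarrow> (\<forall>p<m. c (e p) = (\<Sum>q<m. C $$ (p, q) * g (e q)))"
      using C(1) unfolding vec_eq_iff
      by (simp add: scalar_prod_def atLeast0LessThan cong: sum.cong_simp)
    also have "\<dots> \<longleftrightarrow> (\<forall>k\<in>I. c k = (\<Sum>j\<in>I. C $$ (e' k, e' j) * g j))"
    proof -
      have "(\<forall>p<m. c (e p) = h p) \<longleftrightarrow> (\<forall>k\<in>I. c k = h (e' k))" for h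
        using e' eI e'e by metis
      from this[of "\<lambda>p. \<Sum>q<m. C $$ (p, q) * g (e q)"]
      have "(\<forall>p<m. c (e p) = (\<Sum>q<m. C $$ (p, q) * g (e q))) \<longleftrightarrow>
          (\<forall>k\<in>I. c k = (\<Sum>q<m. C $$ (e' k, q) * g (e q)))" .
      also have "\<dots> \<longleftrightarrow> (\<forall>k\<in>I. c k = (\<Sum>j\<in>I. C $$ (e' k, e' j) * g j))"
        by (simp add: sumI e'e cong: sum.cong_simp)
      finally show ?thesis .
    qed
    finally show "(\<forall>j\<in>I. (\<Sum>k\<in>I. M j k * c k) = g j) \<longleftrightarrow>
        (\<forall>k\<in>I. c k = (\<Sum>j\<in>I. C $$ (e' k, e' j) * g j))"
      by (simp add: Bv)
  qed
qed

subsection \<open>The problem on the reference element\<close>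

text \<open>Exponent pairs serve as single indices, which makes the space-time problem one square
  system for \<open>finite_linear_system_solvable\<close>.\<close>

definition tri :: "nat \<Rightarrow> (nat \<times> nat) set" where
  "tri N = {(a, b). a + b \<le> N}"

lemma finite_tri [simp]: "finite (tri N)"
  by (rule finite_subset[of _ "{..N} \<times> {..N}"]) (auto simp: tri_def)

definition monom_xt :: "nat \<times> nat \<Rightarrow> real \<Rightarrow> real \<Rightarrow> complex" where
  "monom_xt k x t = of_real (x ^ fst k * t ^ snd k)"

text \<open>At exponent 0 the truncated \<open>fst k - 1\<close> is harmless, since the factor
  \<open>real (fst k)\<close> is 0; the time derivative works in the same way.\<close>

definition monom_xt_dx :: "nat \<times> nat \<Rightarrow> real \<Rightarrow> real \<Rightarrow> complex" where
  "monom_xt_dx k x t = of_real (real (fst k) * x ^ (fst k - 1) * t ^ snd k)"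

definition monom_xt_dt :: "nat \<times> nat \<Rightarrow> real \<Rightarrow> real \<Rightarrow> complex" where
  "monom_xt_dt k x t = of_real (x ^ fst k * (real (snd k) * t ^ (snd k - 1)))"

definition ref_poly :: "nat \<Rightarrow> (nat \<times> nat \<Rightarrow> complex) \<Rightarrow> real \<Rightarrow> real \<Rightarrow> complex" where
  "ref_poly N c x t = (\<Sum>k\<in>tri N. c k * monom_xt k x t)"

definition ref_poly_x :: "nat \<Rightarrow> (nat \<times> nat \<Rightarrow> complex) \<Rightarrow> real \<Rightarrow> real \<Rightarrow> complex" where
  "ref_poly_x N c x t = (\<Sum>k\<in>tri N. c k * monom_xt_dx k x t)"

definition ref_poly_t :: "nat \<Rightarrow> (nat \<times> nat \<Rightarrow> complex) \<Rightarrow> real \<Rightarrow> real \<Rightarrow> complex" where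
  "ref_poly_t N c x t = (\<Sum>k\<in>tri N. c k * monom_xt_dt k x t)"

text \<open>This is \<open>dt\<close> times the transport operator in the scaled variables: the time
  derivative carries \<open>1 / dt\<close> and the space derivative \<open>1 / dx\<close>, whence
  \<open>r = dt / dx\<close>.\<close>

definition ref_adv :: "nat \<Rightarrow> real \<Rightarrow> (nat \<times> nat \<Rightarrow> complex) \<Rightarrow> real \<Rightarrow> real \<Rightarrow> complex" where
  "ref_adv N r c x t = ref_poly_t N c x t + of_real r * ref_poly_x N c x t"

definition ref_space :: "nat \<Rightarrow> (nat \<Rightarrow> complex) \<Rightarrow> real \<Rightarrow> complex" where
  "ref_space N v x = (\<Sum>l\<le>N. v l * of_real (x ^ l))"

lemma continuous_monom_xt [continuous_intros]:
  assumes "continuous_on A f" "continuous_on A g"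
  shows "continuous_on A (\<lambda>p. monom_xt k (f p) (g p))"
    and "continuous_on A (\<lambda>p. monom_xt_dx k (f p) (g p))"
    and "continuous_on A (\<lambda>p. monom_xt_dt k (f p) (g p))"
  unfolding monom_xt_def monom_xt_dx_def monom_xt_dt_def by (intro continuous_intros assms)+

lemma continuous_ref_poly [continuous_intros]:
  assumes "continuous_on A f" "continuous_on A g"
  shows "continuous_on A (\<lambda>p. ref_poly N c (f p) (g p))"
    and "continuous_on A (\<lambda>p. ref_poly_x N c (f p) (g p))"
    and "continuous_on A (\<lambda>p. ref_poly_t N c (f p) (g p))"
    and "continuous_on A (\<lambda>p. ref_adv N r c (f p) (g p))"
  unfolding ref_poly_def ref_poly_x_def ref_poly_t_def ref_adv_def
  by (intro continuous_intros assms)+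

lemma continuous_ref_space [continuous_intros]:
  assumes "continuous_on A f"
  shows "continuous_on A (\<lambda>p. ref_space N v (f p))"
  unfolding ref_space_def by (intro continuous_intros assms)

section \<open>Derivatives, conjugates and uniqueness of coefficients\<close>

lemma has_vector_derivative_ref_poly_x:
  "((\<lambda>x. ref_poly N c x t) has_vector_derivative ref_poly_x N c x t) (at x)"
  unfolding ref_poly_def ref_poly_x_def
proof (intro has_vector_derivative_sum has_vector_derivative_mult_right)
  show "((\<lambda>x. monom_xt k x t) has_vector_derivative monom_xt_dx k x t) (at x)" for k
    unfolding monom_xt_def monom_xt_dx_def
    by (rule has_vector_derivative_of_real) (auto intro!: derivative_eq_intros)
qed

lemma has_vector_derivative_ref_poly_t:
  "((\<lambda>t. ref_poly N c x t) has_vector_derivative ref_poly_t N c x t) (at t)"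
  unfolding ref_poly_def ref_poly_t_def
proof (intro has_vector_derivative_sum has_vector_derivative_mult_right)
  show "((\<lambda>t. monom_xt k x t) has_vector_derivative monom_xt_dt k x t) (at t)" for k
    unfolding monom_xt_def monom_xt_dt_def
    by (rule has_vector_derivative_of_real) (auto intro!: derivative_eq_intros)
qed

text \<open>The monomials are real valued, so only the coefficients are conjugated. Hence conjugates
  are admissible test functions, and a bilinear form produces squared norms.\<close>

lemma cnj_ref_poly: "cnj (ref_poly N c x t) = ref_poly N (\<lambda>k. cnj (c k)) x t"
  by (simp add: ref_poly_def monom_xt_def)

lemma cnj_ref_adv: "cnj (ref_adv N r c x t) = ref_adv N r (\<lambda>k. cnj (c k)) x t"
  by (simp add: ref_adv_def ref_poly_x_def ref_poly_t_def monom_xt_dx_def monom_xt_dt_def)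

lemma cnj_ref_space: "cnj (ref_space N v x) = ref_space N (\<lambda>l. cnj (v l)) x"
  by (simp add: ref_space_def)

text \<open>For fixed \<open>x\<close> the polynomial in \<open>t\<close> has zero coefficients;
  each of these is a polynomial in \<open>x\<close> that vanishes on an interval in turn.\<close>

lemma ref_poly_zero:
  assumes "\<And>x t. x \<in> {-1/2..1/2} \<Longrightarrow> t \<in> {0..1} \<Longrightarrow> ref_poly N c x t = 0" and "k \<in> tri N"
  shows "c k = 0"
proof -
  obtain a b where k: "k = (a, b)" "a + b \<le> N"
    using assms(2) by (auto simp: tri_def)
  \<comment> \<open>Extending \<open>c\<close> by zero from the triangle to the full square of
    exponents decouples the two sums.\<close>
  define h where "h i j = (if i + j \<le> N then c (i, j) else 0)" for i j
  have ref: "ref_poly N c x t = (\<Sum>j\<le>N. (\<Sum>i\<le>N. h i j * of_real (x ^ i)) * of_real (t ^ j))" for x t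
  proof -
    have "ref_poly N c x t = (\<Sum>k\<in>{..N} \<times> {..N}. h (fst k) (snd k) * monom_xt k x t)"
      unfolding ref_poly_def
      by (rule sum.mono_neutral_cong_left) (auto simp: tri_def h_def)
    also have "\<dots> = (\<Sum>i\<le>N. \<Sum>j\<le>N. h i j * monom_xt (i, j) x t)"
      by (simp add: sum.cartesian_product case_prod_beta)
    also have "\<dots> = (\<Sum>j\<le>N. (\<Sum>i\<le>N. h i j * of_real (x ^ i)) * of_real (t ^ j))"
      by (subst sum.swap) (simp add: monom_xt_def sum_distrib_left sum_distrib_right mult_ac)
    finally show ?thesis .
  qed
  have "(\<Sum>i\<le>N. h i b * of_real (x ^ i)) = 0" if "x \<in> {-1/2..1/2}" for x
    by (rule polyfun_zero_on_interval[of 0 1 "\<lambda>j. \<Sum>i\<le>N. h i j * of_real (x ^ i)" N])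
      (use assms(1)[OF that] k in \<open>auto simp: ref\<close>)
  then have "h a b = 0"
    by (rule polyfun_zero_on_interval[of "-1/2" "1/2" "\<lambda>i. h i b" N, rotated]) (use k in auto)
  then show ?thesis
    using k by (simp add: h_def)
qed

section \<open>Coefficients of the transport derivative and of the time traces\<close>

definition adv_coeff :: "nat \<Rightarrow> real \<Rightarrow> (nat \<times> nat \<Rightarrow> complex) \<Rightarrow> nat \<times> nat \<Rightarrow> complex" where
  "adv_coeff N r c k = (case k of (a, b) \<Rightarrow> if a + b + 1 \<le> N
     then of_nat (b + 1) * c (a, b + 1) + of_real r * of_nat (a + 1) * c (a + 1, b) else 0)"

text \<open>The transport operator maps the trial space into itself, so the conjugate of the
  residual can be used as a test function.\<close>

lemma ref_adv_eq_ref_poly: "ref_adv N r c x t = ref_poly N (adv_coeff N r c) x t"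
proof -
  define I where "I = {(a, b). a + b + 1 \<le> N}"
  have I: "I \<subseteq> tri N" by (auto simp: I_def tri_def)
  have "ref_poly_t N c x t = (\<Sum>k\<in>{k \<in> tri N. snd k > 0}. c k * monom_xt_dt k x t)"
    unfolding ref_poly_t_def by (rule sum.mono_neutral_right) (auto simp: monom_xt_dt_def)
  \<comment> \<open>Monomials with time exponent 0 have dropped out; the others move down by one in
    that exponent.\<close>
  also have "\<dots> = (\<Sum>(a, b)\<in>I. of_nat (b + 1) * c (a, b + 1) * monom_xt (a, b) x t)"
    by (rule sum.reindex_bij_witness[where i = "\<lambda>(a, b). (a, b + 1)" and j = "\<lambda>(a, b). (a, b - 1)"])
      (auto simp: I_def tri_def monom_xt_dt_def monom_xt_def)
  finally have t: "ref_poly_t N c x t = \<dots>" .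
  have "ref_poly_x N c x t = (\<Sum>k\<in>{k \<in> tri N. fst k > 0}. c k * monom_xt_dx k x t)"
    unfolding ref_poly_x_def by (rule sum.mono_neutral_right) (auto simp: monom_xt_dx_def)
  also have "\<dots> = (\<Sum>(a, b)\<in>I. of_nat (a + 1) * c (a + 1, b) * monom_xt (a, b) x t)"
    by (rule sum.reindex_bij_witness[where i = "\<lambda>(a, b). (a + 1, b)" and j = "\<lambda>(a, b). (a - 1, b)"])
      (auto simp: I_def tri_def monom_xt_dx_def monom_xt_def)
  finally have x: "ref_poly_x N c x t = \<dots>" .
  have "ref_poly N (adv_coeff N r c) x t = (\<Sum>k\<in>I. adv_coeff N r c k * monom_xt k x t)"
    unfolding ref_poly_def
    by (rule sum.mono_neutral_right) (use I in \<open>auto simp: I_def adv_coeff_def\<close>)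
  also have "\<dots> = ref_adv N r c x t"
    unfolding ref_adv_def t x sum_distrib_left sum.distrib[symmetric]
    by (rule sum.cong) (auto simp: I_def adv_coeff_def algebra_simps)
  finally show ?thesis by simp
qed

text \<open>
  The transport equation expresses a coefficient with time exponent \<open>b + 1\<close> by one with time
  exponent \<open>b\<close>.
\<close>

lemma adv_coeff_zero_imp_zero:
  assumes "\<And>k. k \<in> tri N \<Longrightarrow> adv_coeff N r c k = 0"
    and "\<And>a. a \<le> N \<Longrightarrow> c (a, 0) = 0"
    and "k \<in> tri N"
  shows "c k = 0"
proof -
  have "c (a, b) = 0" if "a + b \<le> N" for a b
    using that
  proof (induction b arbitrary: a)
    case 0
    then show ?case using assms(2) by simp
  next
    case (Suc b)
    have "c (a + 1, b) = 0"
      using Suc by simp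
    moreover have "adv_coeff N r c (a, b) = 0"
      using assms(1) Suc.prems by (simp add: tri_def)
    ultimately have "(of_nat (b + 1) :: complex) * c (a, b + 1) = 0"
      using Suc.prems by (simp add: adv_coeff_def)
    then show ?case
      by (simp del: of_nat_Suc of_nat_add)
  qed
  then show ?thesis
    using assms(3) by (auto simp: tri_def)
qed

text \<open>Since \<open>0 ^ 0 = 1\<close>, exactly the monomials with time exponent 0
  survive.\<close>

lemma ref_poly_0: "ref_poly N c x 0 = ref_space N (\<lambda>l. c (l, 0)) x"
proof -
  have "ref_poly N c x 0 = (\<Sum>k\<in>(\<lambda>l. (l, 0)) ` {..N}. c k * monom_xt k x 0)"
    unfolding ref_poly_def
    by (rule sum.mono_neutral_right) (use finite_tri[of N] in \<open>auto simp: tri_def monom_xt_def image_iff\<close>)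
  also have "\<dots> = ref_space N (\<lambda>l. c (l, 0)) x"
    unfolding ref_space_def by (subst sum.reindex) (auto simp: inj_on_def monom_xt_def)
  finally show ?thesis .
qed

text \<open>At \<open>t = 1\<close> all powers of \<open>t\<close> equal 1, so the coefficient of
  \<open>x ^ l\<close> collects every time exponent \<open>b\<close> with
  \<open>l + b \<le> N\<close>.\<close>

definition final_coeff :: "nat \<Rightarrow> (nat \<times> nat \<Rightarrow> complex) \<Rightarrow> nat \<Rightarrow> complex" where
  "final_coeff N c l = (\<Sum>b\<le>N - l. c (l, b))"

lemma ref_poly_1: "ref_poly N c x 1 = ref_space N (final_coeff N c) x"
proof -
  have "tri N = (SIGMA l:{..N}. {..N - l})"
    by (auto simp: tri_def)
  then have "ref_poly N c x 1 = (\<Sum>k\<in>(SIGMA l:{..N}. {..N - l}). c k * of_real (x ^ fst k))"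
    by (simp add: ref_poly_def monom_xt_def)
  also have "\<dots> = (\<Sum>l\<le>N. \<Sum>b\<le>N - l. c (l, b) * of_real (x ^ l))"
    by (simp add: sum.Sigma case_prod_beta)
  finally show ?thesis
    by (simp add: ref_space_def final_coeff_def sum_distrib_right)
qed

text \<open>The left side of the weak formulation divided by \<open>dx\<close>. The upwind trace at
  the left face is the right trace of the left neighbour, for a Fourier mode \<open>z\<close> times
  the element's own right trace; hence the last integral pairs the test function at
  \<open>-1/2\<close> with the solution at \<open>1/2\<close>.\<close>

definition ref_form ::
  "nat \<Rightarrow> real \<Rightarrow> complex \<Rightarrow> (nat \<times> nat \<Rightarrow> complex) \<Rightarrow> (nat \<times> nat \<Rightarrow> complex) \<Rightarrow> complex" where
  "ref_form N r z d c =
     integral {-1/2..1/2} (\<lambda>x. ref_poly N d x 1 * ref_poly N c x 1)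
     - integral ({-1/2..1/2} \<times> {0..1})
         (\<lambda>p. ref_adv N r d (fst p) (snd p) * ref_poly N c (fst p) (snd p))
     + of_real r * integral {0..1} (\<lambda>t. ref_poly N d (1/2) t * ref_poly N c (1/2) t)
     - of_real r * z * integral {0..1} (\<lambda>t. ref_poly N d (-1/2) t * ref_poly N c (1/2) t)"

definition ref_load :: "nat \<Rightarrow> (nat \<times> nat \<Rightarrow> complex) \<Rightarrow> (nat \<Rightarrow> complex) \<Rightarrow> complex" where
  "ref_load N d v = integral {-1/2..1/2} (\<lambda>x. ref_poly N d x 0 * ref_space N v x)"

definition stiffness :: "real \<Rightarrow> complex \<Rightarrow> nat \<times> nat \<Rightarrow> nat \<times> nat \<Rightarrow> complex" where
  "stiffness r z j k =
     integral {-1/2..1/2} (\<lambda>x. monom_xt j x 1 * monom_xt k x 1)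
     - integral ({-1/2..1/2} \<times> {0..1})
         (\<lambda>p. (monom_xt_dt j (fst p) (snd p) + of_real r * monom_xt_dx j (fst p) (snd p))
            * monom_xt k (fst p) (snd p))
     + of_real r * integral {0..1} (\<lambda>t. monom_xt j (1/2) t * monom_xt k (1/2) t)
     - of_real r * z * integral {0..1} (\<lambda>t. monom_xt j (-1/2) t * monom_xt k (1/2) t)"

definition load :: "nat \<times> nat \<Rightarrow> nat \<Rightarrow> complex" where
  "load j l = integral {-1/2..1/2} (\<lambda>x. monom_xt j x 0 * of_real (x ^ l))"

lemma ref_form_eq_sum:
  "ref_form N r z d c = (\<Sum>j\<in>tri N. d j * (\<Sum>k\<in>tri N. stiffness r z j k * c k))"
proof -
  let ?m = "\<lambda>j p. monom_xt_dt j (fst p) (snd p) + of_real r * monom_xt_dx j (fst p) (snd p)"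
  have 1: "integral {-1/2..1/2} (\<lambda>x. ref_poly N d x 1 * ref_poly N c x 1) =
      (\<Sum>j\<in>tri N. d j * (\<Sum>k\<in>tri N. integral {-1/2..1/2} (\<lambda>x. monom_xt j x 1 * monom_xt k x 1) * c k))"
    unfolding ref_poly_def cbox_interval[symmetric]
    by (intro integral_sum_mult_sum finite_tri continuous_intros)
  have 2: "integral {0..1} (\<lambda>t. ref_poly N d y t * ref_poly N c (1/2) t) =
      (\<Sum>j\<in>tri N. d j * (\<Sum>k\<in>tri N. integral {0..1} (\<lambda>t. monom_xt j y t * monom_xt k (1/2) t) * c k))" for y
    unfolding ref_poly_def cbox_interval[symmetric]
    by (intro integral_sum_mult_sum finite_tri continuous_intros)
  have adv: "ref_adv N r d (fst p) (snd p) = (\<Sum>j\<in>tri N. d j * ?m j p)" for p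
    by (simp add: ref_adv_def ref_poly_t_def ref_poly_x_def sum_distrib_left sum.distrib
        algebra_simps)
  have rect: "{-1/2..1/2 :: real} \<times> {0..1 :: real} = cbox (-1/2, 0) (1/2, 1)"
    by (simp add: cbox_Pair_eq del: cbox_interval)
  have 3: "integral ({-1/2..1/2} \<times> {0..1})
         (\<lambda>p. ref_adv N r d (fst p) (snd p) * ref_poly N c (fst p) (snd p)) =
      (\<Sum>j\<in>tri N. d j * (\<Sum>k\<in>tri N. integral ({-1/2..1/2} \<times> {0..1})
         (\<lambda>p. ?m j p * monom_xt k (fst p) (snd p)) * c k))"
    unfolding adv unfolding ref_poly_def rect
    by (intro integral_sum_mult_sum finite_tri continuous_intros)
  show ?thesis
    unfolding ref_form_def 1 2 3 stiffness_def
    by (simp add: algebra_simps sum.distrib sum_subtractf sum_distrib_left)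
qed

lemma ref_load_eq_sum: "ref_load N d v = (\<Sum>j\<in>tri N. d j * (\<Sum>l\<le>N. load j l * v l))"
  unfolding ref_load_def load_def ref_poly_def ref_space_def cbox_interval[symmetric]
  by (intro integral_sum_mult_sum finite_tri finite_atMost continuous_intros)

text \<open>Testing with single monomials gives the rows of the system; linearity in
  \<open>d\<close> gives the converse.\<close>

lemma ref_form_eq_load_iff:
  "(\<forall>d. ref_form N r z d c = ref_load N d v) \<longleftrightarrow>
   (\<forall>j\<in>tri N. (\<Sum>k\<in>tri N. stiffness r z j k * c k) = (\<Sum>l\<le>N. load j l * v l))"
proof
  assume *: "\<forall>d. ref_form N r z d c = ref_load N d v"
  show "\<forall>j\<in>tri N. (\<Sum>k\<in>tri N. stiffness r z j k * c k) = (\<Sum>l\<le>N. load j l * v l)"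
  proof
    fix j assume "j \<in> tri N"
    have del: "(\<Sum>i\<in>tri N. (if i = j then 1 else 0) * f i) = f j" for f :: "nat \<times> nat \<Rightarrow> complex"
      using \<open>j \<in> tri N\<close> by (simp add: if_distrib[of "\<lambda>x. x * _"] cong: if_cong)
    show "(\<Sum>k\<in>tri N. stiffness r z j k * c k) = (\<Sum>l\<le>N. load j l * v l)"
      using *[rule_format, of "\<lambda>i. if i = j then 1 else 0"]
      unfolding ref_form_eq_sum ref_load_eq_sum del .
  qed
qed (simp add: ref_form_eq_sum ref_load_eq_sum)

subsection \<open>Energy identity and unique solvability\<close>

text \<open>The two integrands add up to the derivative of the product of both polynomials along the
  transport direction, so only boundary terms remain. The time part and the space part are
  integrated separately.\<close>

lemma ref_adv_integral_by_parts:
  "integral ({-1/2..1/2} \<times> {0..1})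
      (\<lambda>p. ref_adv N r d (fst p) (snd p) * ref_poly N c (fst p) (snd p)) +
    integral ({-1/2..1/2} \<times> {0..1})
      (\<lambda>p. ref_poly N d (fst p) (snd p) * ref_adv N r c (fst p) (snd p)) =
    integral {-1/2..1/2} (\<lambda>x. ref_poly N d x 1 * ref_poly N c x 1)
    - integral {-1/2..1/2} (\<lambda>x. ref_poly N d x 0 * ref_poly N c x 0)
    + of_real r * (integral {0..1} (\<lambda>t. ref_poly N d (1/2) t * ref_poly N c (1/2) t)
    - integral {0..1} (\<lambda>t. ref_poly N d (-1/2) t * ref_poly N c (-1/2) t))"
proof -
  let ?R = "{-1/2..1/2} \<times> {0..1} :: (real \<times> real) set"
  let ?P = "ref_poly N" and ?X = "ref_poly_x N" and ?T = "ref_poly_t N"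
  have rect: "?R = cbox (-1/2, 0) (1/2, 1)"
    by (simp add: cbox_Pair_eq del: cbox_interval)
  have t: "integral ?R (\<lambda>p. ?P d (fst p) (snd p) * ?T c (fst p) (snd p)
        + ?T d (fst p) (snd p) * ?P c (fst p) (snd p)) =
      integral {-1/2..1/2} (\<lambda>x. ?P d x 1 * ?P c x 1 - ?P d x 0 * ?P c x 0)"
    by (rule integral_rectangle_deriv_snd[of 0 1 "\<lambda>x t. ?P d x t * ?P c x t"
          "\<lambda>x t. ?P d x t * ?T c x t + ?T d x t * ?P c x t"])
      (auto intro!: continuous_intros has_vector_derivative_mult has_vector_derivative_ref_poly_t)
  have x: "integral ?R (\<lambda>p. ?P d (fst p) (snd p) * ?X c (fst p) (snd p)
        + ?X d (fst p) (snd p) * ?P c (fst p) (snd p)) =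
      integral {0..1} (\<lambda>t. ?P d (1/2) t * ?P c (1/2) t - ?P d (-1/2) t * ?P c (-1/2) t)"
    by (rule integral_rectangle_deriv_fst[of "-1/2" "1/2" "\<lambda>x t. ?P d x t * ?P c x t"
          "\<lambda>x t. ?P d x t * ?X c x t + ?X d x t * ?P c x t"])
      (auto intro!: continuous_intros has_vector_derivative_mult has_vector_derivative_ref_poly_x)
  have "integral ?R (\<lambda>p. ref_adv N r d (fst p) (snd p) * ?P c (fst p) (snd p)) +
      integral ?R (\<lambda>p. ?P d (fst p) (snd p) * ref_adv N r c (fst p) (snd p)) =
      integral ?R (\<lambda>p. (?P d (fst p) (snd p) * ?T c (fst p) (snd p)
        + ?T d (fst p) (snd p) * ?P c (fst p) (snd p)) +
        of_real r * (?P d (fst p) (snd p) * ?X c (fst p) (snd p)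
        + ?X d (fst p) (snd p) * ?P c (fst p) (snd p)))"
    unfolding rect
    by (subst integral_add[symmetric])
      (auto intro!: integrable_continuous continuous_intros integral_cong simp: ref_adv_def algebra_simps)
  also have "\<dots> = integral ?R (\<lambda>p. ?P d (fst p) (snd p) * ?T c (fst p) (snd p)
        + ?T d (fst p) (snd p) * ?P c (fst p) (snd p)) +
      of_real r * integral ?R (\<lambda>p. ?P d (fst p) (snd p) * ?X c (fst p) (snd p)
        + ?X d (fst p) (snd p) * ?P c (fst p) (snd p))"
    unfolding rect
    by (subst integral_add) (auto intro!: integrable_continuous continuous_intros)
  also have "\<dots> = integral {-1/2..1/2} (\<lambda>x. ?P d x 1 * ?P c x 1)
    - integral {-1/2..1/2} (\<lambda>x. ?P d x 0 * ?P c x 0)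
    + of_real r * (integral {0..1} (\<lambda>t. ?P d (1/2) t * ?P c (1/2) t)
    - integral {0..1} (\<lambda>t. ?P d (-1/2) t * ?P c (-1/2) t))"
    unfolding t x
    by (subst (1 2) integral_diff) (auto intro!: integrable_continuous_interval continuous_intros)
  finally show ?thesis .
qed

text \<open>The strong form of the problem: the terms at final time and at the right face cancel,
  leaving the initial trace, the residual of the transport equation and the jump at the left
  face.\<close>

lemma ref_form_by_parts:
  "ref_form N r z d c =
     integral {-1/2..1/2} (\<lambda>x. ref_poly N d x 0 * ref_poly N c x 0)
     + integral ({-1/2..1/2} \<times> {0..1})
         (\<lambda>p. ref_poly N d (fst p) (snd p) * ref_adv N r c (fst p) (snd p))
     + of_real r * integral {0..1}
         (\<lambda>t. ref_poly N d (-1/2) t * (ref_poly N c (-1/2) t - z * ref_poly N c (1/2) t))"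
proof -
  let ?P = "ref_poly N"
  have "integral {0..1} (\<lambda>t. ?P d (-1/2) t * (?P c (-1/2) t - z * ?P c (1/2) t)) =
      integral {0..1} (\<lambda>t. ?P d (-1/2) t * ?P c (-1/2) t - z * (?P d (-1/2) t * ?P c (1/2) t))"
    by (simp add: algebra_simps)
  also have "\<dots> = integral {0..1} (\<lambda>t. ?P d (-1/2) t * ?P c (-1/2) t)
      - z * integral {0..1} (\<lambda>t. ?P d (-1/2) t * ?P c (1/2) t)"
    by (subst integral_diff) (auto intro!: integrable_continuous_interval continuous_intros)
  finally have jump: "integral {0..1} (\<lambda>t. ?P d (-1/2) t * (?P c (-1/2) t - z * ?P c (1/2) t)) = \<dots>" .
  show ?thesis
    unfolding jump ref_form_def using ref_adv_integral_by_parts[of N r d c]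
    by (simp add: algebra_simps)
qed

section \<open>Squared norms and the energy identity\<close>

definition sq_norm :: "real \<Rightarrow> real \<Rightarrow> (real \<Rightarrow> complex) \<Rightarrow> real" where
  "sq_norm a b f = integral {a..b} (\<lambda>x. (cmod (f x))\<^sup>2)"

text \<open>A function that is not integrable has integral 0 by convention, so no continuity is
  assumed.\<close>

lemma sq_norm_nonneg: "sq_norm a b f \<ge> 0"
proof (cases "(\<lambda>x. (cmod (f x))\<^sup>2) integrable_on {a..b}")
  case True
  then show ?thesis
    unfolding sq_norm_def by (rule Henstock_Kurzweil_Integration.integral_nonneg) simp
qed (simp add: sq_norm_def not_integrable_integral)

lemma of_real_sq_norm:
  assumes "continuous_on UNIV f"
  shows "complex_of_real (sq_norm a b f) = integral {a..b} (\<lambda>x. f x * cnj (f x))"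
proof -
  have "continuous_on (cbox a b) f"
    using assms continuous_on_subset by blast
  from integral_cmod_power2[OF this] show ?thesis
    by (simp only: sq_norm_def cbox_interval)
qed

lemma sq_norm_eq_0:
  assumes "continuous_on UNIV f" "a < b" "sq_norm a b f = 0" "x \<in> {a..b}"
  shows "f x = 0"
proof -
  have "continuous_on {a..b} (\<lambda>x. (cmod (f x))\<^sup>2)"
    using assms(1) by (intro continuous_intros) (use continuous_on_subset in blast)
  from integral_eq_0_iff[OF this assms(2)] assms(3,4) show ?thesis
    by (simp add: sq_norm_def)
qed

text \<open>The two cross terms of the expanded square are conjugate to each other, so one integral
  describes both.\<close>

lemma of_real_sq_norm_diff:
  assumes f: "continuous_on UNIV f" and g: "continuous_on UNIV g"
  shows "complex_of_real (sq_norm a b (\<lambda>x. f x - g x)) =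
    of_real (sq_norm a b f) + of_real (sq_norm a b g)
    - integral {a..b} (\<lambda>x. cnj (f x) * g x) - cnj (integral {a..b} (\<lambda>x. cnj (f x) * g x))"
proof -
  have c: "continuous_on {a..b} f" "continuous_on {a..b} g"
    using f g continuous_on_subset by blast+
  have "complex_of_real (sq_norm a b (\<lambda>x. f x - g x)) =
    integral {a..b} (\<lambda>x. (f x * cnj (f x) + g x * cnj (g x)) - (cnj (f x) * g x + f x * cnj (g x)))"
    by (subst of_real_sq_norm) (auto intro!: continuous_intros f g simp: algebra_simps)
  also have "\<dots> = integral {a..b} (\<lambda>x. f x * cnj (f x)) + integral {a..b} (\<lambda>x. g x * cnj (g x))
     - (integral {a..b} (\<lambda>x. cnj (f x) * g x) + integral {a..b} (\<lambda>x. f x * cnj (g x)))"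
    by (simp add: integral_add integral_diff integrable_continuous_interval continuous_intros c
        integrable_add)
  finally show ?thesis
    by (simp add: of_real_sq_norm f g integral_cnj)
qed

text \<open>The tested equation and its conjugate are added; integration by parts turns the volume
  terms into boundary terms, which complete the squares at initial time and at the left face. The
  computation is complex and returns to the reals at the end.\<close>

lemma energy_identity:
  assumes z: "cmod z = 1" and sol: "\<And>d. ref_form N r z d c = ref_load N d v"
  shows "sq_norm (-1/2) (1/2) (\<lambda>x. ref_poly N c x 1)
    + sq_norm (-1/2) (1/2) (\<lambda>x. ref_poly N c x 0 - ref_space N v x)
    + r * sq_norm 0 1 (\<lambda>t. ref_poly N c (-1/2) t - z * ref_poly N c (1/2) t)
    = sq_norm (-1/2) (1/2) (ref_space N v)"
proof -
  let ?P = "ref_poly N c" and ?A = "ref_adv N r c" and ?S = "ref_space N v"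
  \<comment> \<open>Coefficients of the conjugate of the solution, the test function.\<close>
  let ?d = "\<lambda>k. cnj (c k)"
  define J where "J = integral ({-1/2..1/2} \<times> {0..1})
      (\<lambda>p. cnj (?P (fst p) (snd p)) * ?A (fst p) (snd p))"
  define C where "C = integral {0..1} (\<lambda>t. cnj (?P (-1/2) t) * ?P (1/2) t)"
  define l where "l = integral {-1/2..1/2} (\<lambda>x. cnj (?P x 0) * ?S x)"
  define E where "E y = complex_of_real (sq_norm (-1/2) (1/2) (\<lambda>x. ?P x y))" for y
  define F where "F y = complex_of_real (sq_norm 0 1 (\<lambda>t. ?P y t))" for y
  define U where "U = complex_of_real (sq_norm (-1/2) (1/2) ?S)"
  have S: "continuous_on UNIV ?S"
    using continuous_ref_space[OF continuous_on_id] by simp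
  have E: "integral {-1/2..1/2} (\<lambda>x. cnj (?P x y) * ?P x y) = E y" for y
    unfolding E_def by (subst of_real_sq_norm) (auto intro!: continuous_intros simp: mult.commute)
  have F: "integral {0..1} (\<lambda>t. cnj (?P y t) * ?P y t) = F y" for y
    unfolding F_def by (subst of_real_sq_norm) (auto intro!: continuous_intros simp: mult.commute)
  have load: "ref_load N ?d v = l"
    by (simp add: ref_load_def l_def cnj_ref_poly)
  have cnjJ: "cnj J = integral ({-1/2..1/2} \<times> {0..1}) (\<lambda>p. cnj (?A (fst p) (snd p)) * ?P (fst p) (snd p))"
    unfolding J_def integral_cnj by (simp add: mult.commute)
  have l1: "l = E 1 - cnj J + of_real r * F (1/2) - of_real r * z * C"
    using sol[of ?d]
    unfolding load ref_form_def cnj_ref_poly[symmetric] cnj_ref_adv[symmetric] E F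
      C_def[symmetric] cnjJ[symmetric] by (rule sym)
  have ibp: "cnj J + J = E 1 - E 0 + of_real r * (F (1/2) - F (-1/2))"
    using ref_adv_integral_by_parts[of N r ?d c]
    unfolding cnj_ref_poly[symmetric] cnj_ref_adv[symmetric] E F J_def[symmetric] cnjJ[symmetric] .
  have jump: "complex_of_real (sq_norm 0 1 (\<lambda>t. ?P (-1/2) t - z * ?P (1/2) t)) =
      F (-1/2) + F (1/2) - z * C - cnj (z * C)"
  proof -
    \<comment> \<open>The phase factor has modulus one and hence preserves the norm of the incoming
      trace; only then do the face terms form a square.\<close>
    have "sq_norm 0 1 (\<lambda>t. z * ?P (1/2) t) = sq_norm 0 1 (\<lambda>t. ?P (1/2) t)"
      by (simp add: sq_norm_def norm_mult z)
    moreover have "integral {0..1} (\<lambda>t. cnj (?P (-1/2) t) * (z * ?P (1/2) t)) = z * C"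
      unfolding C_def by (simp add: mult.left_commute)
    ultimately show ?thesis
      by (subst of_real_sq_norm_diff) (auto intro!: continuous_intros simp: F_def)
  qed
  have init: "complex_of_real (sq_norm (-1/2) (1/2) (\<lambda>x. ?P x 0 - ?S x)) = E 0 + U - l - cnj l"
    by (subst of_real_sq_norm_diff) (auto intro!: continuous_intros S simp: E_def U_def l_def)
  have "cnj (E y) = E y" "cnj (F y) = F y" for y
    by (simp_all add: E_def F_def)
  then have l2: "cnj l = E 1 - J + of_real r * F (1/2) - of_real r * cnj (z * C)"
    by (simp add: l1)
  \<comment> \<open>This formula removes \<open>J + cnj J\<close>, after \<open>l\<close> and
    \<open>cnj l\<close> have been replaced by \<open>l1\<close> and \<open>l2\<close>.\<close>
  have "E 0 = E 1 + of_real r * (F (1/2) - F (-1/2)) - cnj J - J"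
    using ibp by (simp add: algebra_simps)
  then have "E 1 + (E 0 + U - l - cnj l)
      + of_real r * (F (-1/2) + F (1/2) - z * C - cnj (z * C)) = U"
    unfolding l2 by (subst l1) (simp only: algebra_simps, simp)
  then show ?thesis
    unfolding init[symmetric] jump[symmetric] unfolding E_def U_def
    by (simp only: of_real_add[symmetric] of_real_mult[symmetric] of_real_eq_iff)
qed

lemma ref_solution_unique:
  assumes z: "cmod z = 1" and r: "r > 0"
    and sol: "\<And>d. ref_form N r z d c = 0" and k: "k \<in> tri N"
  shows "c k = 0"
proof -
  let ?P = "ref_poly N c" and ?J = "\<lambda>t. ref_poly N c (-1/2) t - z * ref_poly N c (1/2) t"
  have "ref_load N d (\<lambda>_. 0) = 0" for d
    by (simp add: ref_load_def ref_space_def)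
  then have "sq_norm (-1/2) (1/2) (\<lambda>x. ?P x 1) + sq_norm (-1/2) (1/2) (\<lambda>x. ?P x 0)
      + r * sq_norm 0 1 ?J = 0"
    using energy_identity[OF z, of N r c "\<lambda>_. 0"] sol
    by (simp add: ref_space_def[of N "\<lambda>_. 0"] sq_norm_def[of _ _ "ref_space N (\<lambda>_. 0)"])
  moreover have "r * sq_norm 0 1 ?J \<ge> 0"
    using r by (simp add: sq_norm_nonneg)
  \<comment> \<open>Three nonnegative terms add up to 0.\<close>
  ultimately have "sq_norm (-1/2) (1/2) (\<lambda>x. ?P x 0) = 0" "r * sq_norm 0 1 ?J = 0"
    using sq_norm_nonneg[of "-1/2" "1/2" "\<lambda>x. ?P x 1"] sq_norm_nonneg[of "-1/2" "1/2" "\<lambda>x. ?P x 0"]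
    by linarith+
  then have n0: "sq_norm (-1/2) (1/2) (\<lambda>x. ?P x 0) = 0" and nJ: "sq_norm 0 1 ?J = 0"
    using r by simp_all
  have P0: "?P x 0 = 0" if "x \<in> {-1/2..1/2}" for x
    by (rule sq_norm_eq_0[OF _ _ n0 that]) (auto intro!: continuous_intros)
  have J: "?J t = 0" if "t \<in> {0..1}" for t
    by (rule sq_norm_eq_0[OF _ _ nJ that]) (auto intro!: continuous_intros)
  let ?e = "adv_coeff N r c"
  let ?R = "{-1/2..1/2} \<times> {0..1} :: (real \<times> real) set"
  have rect: "?R = cbox (-1/2, 0) (1/2, 1)"
    by (simp add: cbox_Pair_eq del: cbox_interval)
  have "integral {-1/2..1/2} (\<lambda>x. ref_poly N d x 0 * ?P x 0) = 0"
       "integral {0..1} (\<lambda>t. ref_poly N d (-1/2) t * ?J t) = 0" for d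
    using P0 J by (auto intro!: integral_unique has_integral_is_0)
  \<comment> \<open>In the strong form only the residual \<open>ref_poly N ?e\<close> is left to be
    tested.\<close>
  then have "integral ?R (\<lambda>p. ref_poly N d (fst p) (snd p) * ref_poly N ?e (fst p) (snd p)) = 0" for d
    using sol[of d] by (simp add: ref_form_by_parts ref_adv_eq_ref_poly)
  from this[of "\<lambda>k. cnj (?e k)"]
  have "integral ?R (\<lambda>p. ref_poly N ?e (fst p) (snd p) * cnj (ref_poly N ?e (fst p) (snd p))) = 0"
    by (simp add: cnj_ref_poly[symmetric] mult.commute)
  then have "complex_of_real (integral ?R (\<lambda>p. (cmod (ref_poly N ?e (fst p) (snd p)))\<^sup>2)) = 0"
    unfolding rect by (subst integral_cmod_power2) (auto intro!: continuous_intros)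
  then have "integral ?R (\<lambda>p. (cmod (ref_poly N ?e (fst p) (snd p)))\<^sup>2) = 0"
    by (simp only: of_real_eq_0_iff)
  moreover have "box (-1/2, 0) (1/2, 1 :: real) \<noteq> ({} :: (real \<times> real) set)"
    by (auto simp: box_ne_empty Basis_prod_def)
  moreover have "continuous_on ?R (\<lambda>p. (cmod (ref_poly N ?e (fst p) (snd p)))\<^sup>2)"
    by (intro continuous_intros)
  ultimately have "\<forall>p\<in>?R. (cmod (ref_poly N ?e (fst p) (snd p)))\<^sup>2 = 0"
    unfolding rect by (subst (asm) integral_cbox_eq_0_iff) auto
  then have "ref_poly N ?e x t = 0" if "x \<in> {-1/2..1/2}" "t \<in> {0..1}" for x t
    using that by auto
  then have e: "?e k = 0" if "k \<in> tri N" for k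
    using ref_poly_zero that by blast
  \<comment> \<open>The vanishing initial trace gives the coefficients with time exponent 0, from
    which the recursion in the time exponent starts.\<close>
  have c0: "c (a, 0) = 0" if "a \<le> N" for a
    by (rule polyfun_zero_on_interval[of "-1/2" "1/2" "\<lambda>a. c (a, 0)" N])
      (use P0 that in \<open>auto simp: ref_poly_0 ref_space_def\<close>)
  show ?thesis
    by (rule adv_coeff_zero_imp_zero[OF e c0 k])
qed

text \<open>Stated as an equivalence, so that \<open>R\<close> encodes unique solvability together
  with the solution. Coefficients are compared on \<open>tri N\<close> only, as the others do not
  enter the polynomial.\<close>

definition is_solution_map ::
  "nat \<Rightarrow> real \<Rightarrow> complex \<Rightarrow> (nat \<times> nat \<Rightarrow> nat \<Rightarrow> complex) \<Rightarrow> bool" where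
  "is_solution_map N r z R \<longleftrightarrow> (\<forall>c v. (\<forall>d. ref_form N r z d c = ref_load N d v) \<longleftrightarrow>
    (\<forall>k\<in>tri N. c k = (\<Sum>l\<le>N. R k l * v l)))"

text \<open>\<open>R\<close> is the inverse of the stiffness matrix composed with the load
  matrix.\<close>

lemma ref_solution_map:
  assumes "cmod z = 1" "r > 0"
  obtains R where "is_solution_map N r z R"
proof -
  have "\<exists>Q. \<forall>g c. (\<forall>j\<in>tri N. (\<Sum>k\<in>tri N. stiffness r z j k * c k) = g j) \<longleftrightarrow>
      (\<forall>k\<in>tri N. c k = (\<Sum>j\<in>tri N. Q k j * g j))"
  proof (rule finite_linear_system_solvable[OF finite_tri, of N "stiffness r z"])
    fix c :: "nat \<times> nat \<Rightarrow> complex" and k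
    assume "\<And>j. j \<in> tri N \<Longrightarrow> (\<Sum>k\<in>tri N. stiffness r z j k * c k) = 0" "k \<in> tri N"
    moreover from this have "ref_form N r z d c = 0" for d
      by (simp add: ref_form_eq_sum)
    ultimately show "c k = 0"
      using ref_solution_unique[OF assms, of N c k] by blast
  qed blast
  then obtain Q where Q: "\<And>g c. (\<forall>j\<in>tri N. (\<Sum>k\<in>tri N. stiffness r z j k * c k) = g j) \<longleftrightarrow>
      (\<forall>k\<in>tri N. c k = (\<Sum>j\<in>tri N. Q k j * g j))"
    by blast
  have *: "(\<Sum>j\<in>tri N. Q k j * (\<Sum>l\<le>N. load j l * v l)) =
      (\<Sum>l\<le>N. (\<Sum>j\<in>tri N. Q k j * load j l) * v l)" for k v
    by (simp add: sum_distrib_left sum_distrib_right mult.assoc) (rule sum.swap)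
  show thesis
    by (rule that[of "\<lambda>k l. \<Sum>j\<in>tri N. Q k j * load j l"])
      (simp add: is_solution_map_def ref_form_eq_load_iff Q *)
qed

subsection \<open>Scaling to the grid and the amplification matrix\<close>

lemma space_poly_eq_ref:
  "space_poly N dx i v x = ref_space N (vec_index v) ((x - cell_centre dx i) / dx)"
  by (simp add: space_poly_def ref_space_def)

lemma st_poly_eq_ref:
  "st_poly N dx dt i n c x t =
    ref_poly N (case_prod c) ((x - cell_centre dx i) / dx) ((t - time_level dt n) / dt)"
  by (auto simp: st_poly_def ref_poly_def tri_def monom_xt_def intro!: sum.cong)

text \<open>Each endpoint is written as origin plus size times reference coordinate, the shape that
  \<open>integral_affine\<close> expects.\<close>

lemma cell_bounds:
  "cell_left dx i = cell_centre dx i + dx * (-1/2)"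
  "cell_right dx i = cell_centre dx i + dx * (1/2)"
  "time_level dt n = time_level dt n + dt * 0"
  "time_level dt (n + 1) = time_level dt n + dt * 1"
  by (simp_all add: cell_centre_def cell_left_def cell_right_def time_level_def field_simps)

lemma vector_derivative_scaled:
  fixes f :: "real \<Rightarrow> complex"
  assumes "\<And>y. (f has_vector_derivative f' y) (at y)"
  shows "vector_derivative (\<lambda>x. f ((x - m) / h)) (at x) = f' ((x - m) / h) / of_real h"
proof -
  have "((\<lambda>x. (x - m) / h) has_vector_derivative 1 / h) (at x)"
    unfolding has_real_derivative_iff_has_vector_derivative[symmetric]
    \<comment> \<open>For \<open>h = 0\<close> division by zero makes the map constant and the
      claimed derivative 0.\<close>
    by (cases "h = 0") (auto intro!: derivative_eq_intros)
  from vector_diff_chain_at[OF this assms]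
  have "((\<lambda>x. f ((x - m) / h)) has_vector_derivative f' ((x - m) / h) / of_real h) (at x)"
    by (simp add: o_def scaleR_conv_of_real)
  then show ?thesis
    by (rule vector_derivative_at)
qed

text \<open>Every term carries the factor \<open>dx\<close>: space integrals scale by
  \<open>dx\<close>, face integrals by \<open>dt = dx * r\<close>, and the volume integral by
  \<open>dx * dt\<close> with \<open>1 / dt\<close> coming from the derivatives.\<close>

lemma weak_form_iff_ref_form:
  assumes dx: "dx > 0" and dt: "dt > 0"
    and qL: "\<And>t. qL t = z * ref_poly N (case_prod c) (1/2) ((t - time_level dt n) / dt)"
  shows "weak_form dx dt i n (space_poly N dx i v) (st_poly N dx dt i n c) qL qR
      (st_poly N dx dt i n d) \<longleftrightarrow>
    ref_form N (dt / dx) z (case_prod d) (case_prod c) = ref_load N (case_prod d) (vec_index v)"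
proof -
  let ?a = "cell_left dx i" and ?b = "cell_right dx i"
  let ?s = "time_level dt n" and ?s' = "time_level dt (n + 1)" and ?m = "cell_centre dx i"
  let ?C = "ref_poly N (case_prod c)" and ?D = "ref_poly N (case_prod d)"
  let ?A = "ref_adv N (dt / dx) (case_prod d)"
  let ?q = "st_poly N dx dt i n c" and ?\<psi> = "st_poly N dx dt i n d"
  note ab = cell_bounds(1,2)[of dx i] and ss' = cell_bounds(3,4)[of dt n]
  have 1: "integral {?a..?b} (\<lambda>x. ?\<psi> x ?s' * ?q x ?s') =
      of_real dx * integral {-1/2..1/2} (\<lambda>x. ?D x 1 * ?C x 1)"
  proof -
    have "(?s' - ?s) / dt = 1"
      using dt by (simp add: time_level_def field_simps)
    then show ?thesis
      unfolding st_poly_eq_ref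
      by (subst integral_affine[OF dx _ ab, of "\<lambda>x. ?D x 1 * ?C x 1", symmetric])
        (auto intro!: continuous_intros)
  qed
  have 2: "integral {?a..?b} (\<lambda>x. ?\<psi> x ?s * space_poly N dx i v x) =
      of_real dx * ref_load N (case_prod d) (vec_index v)"
    unfolding st_poly_eq_ref space_poly_eq_ref ref_load_def
    by (subst integral_affine[OF dx _ ab, of "\<lambda>x. ?D x 0 * ref_space N (vec_index v) x", symmetric])
      (auto intro!: continuous_intros)
  have at: "(?a - ?m) / dx = -1/2" "(?b - ?m) / dx = 1/2"
    using dx by (simp_all add: ab)
  have 3: "integral {?s..?s'} (\<lambda>t. ?\<psi> ?b t * rusanov_flux 0 (?q ?b t) (qR t) (1, 0)) =
      of_real dt * integral {0..1} (\<lambda>t. ?D (1/2) t * ?C (1/2) t)"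
    unfolding rusanov_flux_right st_poly_eq_ref at
    by (subst integral_affine[OF dt _ ss', of "\<lambda>t. ?D (1/2) t * ?C (1/2) t", symmetric])
      (auto intro!: continuous_intros)
  have 4: "integral {?s..?s'} (\<lambda>t. ?\<psi> ?a t * rusanov_flux 0 (?q ?a t) (qL t) (-1, 0)) =
      - (of_real dt * z * integral {0..1} (\<lambda>t. ?D (-1/2) t * ?C (1/2) t))"
  proof -
    have "integral {?s..?s'} (\<lambda>t. ?D (-1/2) ((t - ?s) / dt) * ?C (1/2) ((t - ?s) / dt)) =
        of_real dt * integral {0..1} (\<lambda>t. ?D (-1/2) t * ?C (1/2) t)"
      by (rule integral_affine[OF dt _ ss']) (auto intro!: continuous_intros)
    then show ?thesis
      unfolding rusanov_flux_left st_poly_eq_ref at qL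
      by (simp add: mult.left_commute)
  qed
  have 5: "integral ({?a..?b} \<times> {?s..?s'})
      (\<lambda>(x, t). (vector_derivative (\<lambda>\<tau>. ?\<psi> x \<tau>) (at t)
          + vector_derivative (\<lambda>\<xi>. ?\<psi> \<xi> t) (at x)) * ?q x t) =
      of_real dx * integral ({-1/2..1/2} \<times> {0..1}) (\<lambda>p. ?A (fst p) (snd p) * ?C (fst p) (snd p))"
  proof -
    \<comment> \<open>The chain rule yields \<open>1 / dt\<close> and \<open>1 / dx\<close>;
      factoring out \<open>1 / dt\<close> leaves the ratio \<open>dt / dx\<close> inside
      \<open>ref_adv\<close>.\<close>
    have "(\<lambda>(x, t). (vector_derivative (\<lambda>\<tau>. ?\<psi> x \<tau>) (at t)
          + vector_derivative (\<lambda>\<xi>. ?\<psi> \<xi> t) (at x)) * ?q x t) =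
        (\<lambda>(x, t). ?A ((x - ?m) / dx) ((t - ?s) / dt) * ?C ((x - ?m) / dx) ((t - ?s) / dt) / of_real dt)"
      unfolding st_poly_eq_ref
        vector_derivative_scaled[OF has_vector_derivative_ref_poly_x]
        vector_derivative_scaled[OF has_vector_derivative_ref_poly_t]
      using dx dt by (auto simp: ref_adv_def fun_eq_iff field_simps)
    then show ?thesis
      using integral_affine_rectangle[OF dx dt _ ab ss',
          of "\<lambda>p. ?A (fst p) (snd p) * ?C (fst p) (snd p) / of_real dt"] dt
      by (simp add: continuous_intros)
  qed
  have "weak_form dx dt i n (space_poly N dx i v) ?q qL qR ?\<psi> \<longleftrightarrow>
      of_real dx * ref_form N (dt / dx) z (case_prod d) (case_prod c) =
      of_real dx * ref_load N (case_prod d) (vec_index v)"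
    unfolding weak_form_def Let_def 1 2 3 4 5 ref_form_def
    using dx by (simp add: algebra_simps)
  then show ?thesis
    using dx by simp
qed

text \<open>The final trace already has degree at most \<open>N\<close>, so it is its own
  projection. Uniqueness follows by testing with the conjugate of the difference.\<close>

lemma is_L2_projection_iff:
  assumes dx: "dx > 0" and dt: "dt > 0" and u: "u \<in> carrier_vec (N + 1)"
  shows "is_L2_projection N dx i (\<lambda>x. st_poly N dx dt i n c x (time_level dt (n + 1)))
      (space_poly N dx i u) \<longleftrightarrow> (\<forall>l\<le>N. vec_index u l = final_coeff N (case_prod c) l)"
proof -
  let ?f = "final_coeff N (case_prod c)"
  have tl: "(time_level dt (n + 1) - time_level dt n) / dt = 1"
    using dt by (simp add: time_level_def field_simps)
  have g: "st_poly N dx dt i n c x (time_level dt (n + 1)) =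
      ref_space N ?f ((x - cell_centre dx i) / dx)" for x
    unfolding st_poly_eq_ref tl ref_poly_1 ..
  have int: "integral {cell_left dx i..cell_right dx i} (\<lambda>x.
        ref_space N w ((x - cell_centre dx i) / dx) * ref_space N h ((x - cell_centre dx i) / dx)) =
      of_real dx * integral {-1/2..1/2} (\<lambda>x. ref_space N w x * ref_space N h x)" for w h
    by (subst integral_affine[OF dx _ cell_bounds(1,2),
          of "\<lambda>x. ref_space N w x * ref_space N h x", symmetric])
      (auto intro!: continuous_intros)
  have dx0: "complex_of_real dx \<noteq> 0"
    using dx by simp
  have "space_poly N dx i u \<in> space_polys N dx i"
    using u by (simp add: space_polys_def)
  then have iff: "is_L2_projection N dx i (\<lambda>x. st_poly N dx dt i n c x (time_level dt (n + 1)))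
      (space_poly N dx i u) \<longleftrightarrow> (\<forall>w\<in>carrier_vec (N + 1).
        integral {-1/2..1/2} (\<lambda>x. ref_space N (vec_index w) x * ref_space N (vec_index u) x) =
        integral {-1/2..1/2} (\<lambda>x. ref_space N (vec_index w) x * ref_space N ?f x))"
    unfolding is_L2_projection_def g
    unfolding space_polys_def ball_simps(9) space_poly_eq_ref int mult_left_cancel[OF dx0]
    by simp
  show ?thesis
  proof
    assume "\<forall>l\<le>N. vec_index u l = ?f l"
    then have "ref_space N (vec_index u) = ref_space N ?f"
      by (simp add: ref_space_def fun_eq_iff)
    then show "is_L2_projection N dx i (\<lambda>x. st_poly N dx dt i n c x (time_level dt (n + 1)))
        (space_poly N dx i u)"
      unfolding iff by simp
  next
    assume "is_L2_projection N dx i (\<lambda>x. st_poly N dx dt i n c x (time_level dt (n + 1)))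
        (space_poly N dx i u)"
    note * = this[unfolded iff]
    define h where "h l = vec_index u l - ?f l" for l
    have h: "ref_space N h x = ref_space N (vec_index u) x - ref_space N ?f x" for x
      by (simp add: ref_space_def h_def algebra_simps sum_subtractf)
    \<comment> \<open>Coefficients of the conjugate of \<open>h\<close>, whose test gives the
      squared norm of \<open>h\<close>.\<close>
    define w where "w = Matrix.vec (N + 1) (\<lambda>l. cnj (h l))"
    have w: "ref_space N (vec_index w) x = cnj (ref_space N h x)" for x
      by (simp add: cnj_ref_space) (simp add: ref_space_def w_def)
    have "integral {-1/2..1/2} (\<lambda>x. cnj (ref_space N h x) * ref_space N (vec_index u) x) =
        integral {-1/2..1/2} (\<lambda>x. cnj (ref_space N h x) * ref_space N ?f x)"
      using *[rule_format, of w] unfolding w by (simp add: w_def)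
    then have "integral {-1/2..1/2} (\<lambda>x. cnj (ref_space N h x) * ref_space N (vec_index u) x
        - cnj (ref_space N h x) * ref_space N ?f x) = 0"
      by (subst integral_diff) (auto intro!: integrable_continuous_interval continuous_intros)
    also have "(\<lambda>x. cnj (ref_space N h x) * ref_space N (vec_index u) x
        - cnj (ref_space N h x) * ref_space N ?f x) = (\<lambda>x. ref_space N h x * cnj (ref_space N h x))"
      by (simp add: h algebra_simps)
    finally have "complex_of_real (sq_norm (-1/2) (1/2) (\<lambda>x. ref_space N h x)) = 0"
      by (subst of_real_sq_norm) (auto intro!: continuous_intros)
    then have n: "sq_norm (-1/2) (1/2) (\<lambda>x. ref_space N h x) = 0"
      by (simp only: of_real_eq_0_iff)
    have "ref_space N h x = 0" if "x \<in> {-1/2..1/2}" for x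
      by (rule sq_norm_eq_0[OF _ _ n that]) (auto intro!: continuous_intros)
    then have "h l = 0" if "l \<le> N" for l
      by (intro polyfun_zero_on_interval[of "-1/2" "1/2" h N, OF _ _ that]) (auto simp: ref_space_def)
    then show "\<forall>l\<le>N. vec_index u l = ?f l"
      by (simp add: h_def)
  qed
qed

lemma mesh_pos: "Ne > 0 \<Longrightarrow> mesh Ne > 0"
  by (simp add: mesh_def)

text \<open>The phase relation expresses the neighbour's trace by the element's own coefficients, so
  the global step decouples into one reference problem per element.\<close>

lemma ader_dg_step_iff:
  assumes Ne: "Ne > 0" and dt: "dt > 0"
    and R: "is_solution_map N (dt / mesh Ne) z R"
    and phase: "\<forall>j\<in>{1..Ne}. \<forall>l1 l2. l1 + l2 \<le> N \<longrightarrow>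
      c (left_nb Ne j) l1 l2 = z * c j l1 l2"
  shows "ader_dg_step N Ne dt n U c U' \<longleftrightarrow> (\<forall>j\<in>{1..Ne}.
    U j \<in> carrier_vec (N + 1) \<and> U' j \<in> carrier_vec (N + 1) \<and>
    (\<forall>l1 l2. l1 + l2 \<le> N \<longrightarrow> c j l1 l2 = (\<Sum>l\<le>N. R (l1, l2) l * vec_index (U j) l)) \<and>
    (\<forall>l\<le>N. vec_index (U' j) l = final_coeff N (case_prod (c j)) l))"
proof -
  let ?dx = "mesh Ne"
  have dx: "?dx > 0" using mesh_pos[OF Ne] .
  have weak: "(\<forall>\<psi>\<in>st_polys N ?dx dt j n. weak_form ?dx dt j n
      (space_poly N ?dx j (U j)) (st_poly N ?dx dt j n (c j))
      (\<lambda>t. st_poly N ?dx dt (left_nb Ne j) n (c (left_nb Ne j)) (cell_right ?dx (left_nb Ne j)) t)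
      (\<lambda>t. st_poly N ?dx dt (right_nb Ne j) n (c (right_nb Ne j)) (cell_left ?dx (right_nb Ne j)) t) \<psi>)
    \<longleftrightarrow> (\<forall>l1 l2. l1 + l2 \<le> N \<longrightarrow> c j l1 l2 = (\<Sum>l\<le>N. R (l1, l2) l * vec_index (U j) l))"
    if j: "j \<in> {1..Ne}" for j
  proof -
    have qL: "st_poly N ?dx dt (left_nb Ne j) n (c (left_nb Ne j)) (cell_right ?dx (left_nb Ne j)) t =
        z * ref_poly N (case_prod (c j)) (1/2) ((t - time_level dt n) / dt)" for t
    proof -
      \<comment> \<open>The neighbour's own right endpoint has reference coordinate
        \<open>1/2\<close>, also across the periodic boundary.\<close>
      have "(cell_right ?dx (left_nb Ne j) - cell_centre ?dx (left_nb Ne j)) / ?dx = 1/2"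
        using dx by (simp add: cell_bounds(2))
      then show ?thesis
        unfolding st_poly_eq_ref ref_poly_def sum_distrib_left
        by (simp only:, intro sum.cong) (auto simp: tri_def phase[rule_format, OF j] mult.assoc)
    qed
    \<comment> \<open>Curried and uncurried coefficient functions range over the same test
      functions.\<close>
    have "(\<forall>d. ref_form N (dt / ?dx) z (case_prod d) (case_prod (c j)) =
        ref_load N (case_prod d) (vec_index (U j))) \<longleftrightarrow>
      (\<forall>d. ref_form N (dt / ?dx) z d (case_prod (c j)) = ref_load N d (vec_index (U j)))"
      by (metis case_prod_curry)
    then show ?thesis
      unfolding st_polys_def using weak_form_iff_ref_form[OF dx dt qL]
      by (auto simp: R[unfolded is_solution_map_def, rule_format] tri_def)
  qed
  show ?thesis
    unfolding ader_dg_step_def Let_def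
    by (intro weak is_L2_projection_iff[OF dx dt] conj_cong refl ball_cong)
qed

section \<open>The amplification matrix and its eigenvalues\<close>

lemma mat_eqI_mult_vec:
  fixes A B :: "'a::semiring_1 mat"
  assumes "A \<in> carrier_mat m n" "B \<in> carrier_mat m n"
    and eq: "\<And>v. v \<in> carrier_vec n \<Longrightarrow> A *\<^sub>v v = B *\<^sub>v v"
  shows "A = B"
proof (rule eq_matI)
  fix i j assume "i < dim_row B" "j < dim_col B"
  with assms(1,2) arg_cong[OF eq[of "unit_vec n j"], of "\<lambda>v. vec_index v i"]
  show "A $$ (i, j) = B $$ (i, j)"
    by (simp add: carrier_matD)
qed (use assms in auto)

text \<open>The solution map followed by evaluation at the final time, as in
  \<open>final_coeff\<close>.\<close>

definition amp_mat :: "nat \<Rightarrow> (nat \<times> nat \<Rightarrow> nat \<Rightarrow> complex) \<Rightarrow> complex mat" where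
  "amp_mat N R = Matrix.mat (N + 1) (N + 1) (\<lambda>(l, m). \<Sum>b\<le>N - l. R (l, b) m)"

lemma amp_mat_carrier: "amp_mat N R \<in> carrier_mat (N + 1) (N + 1)"
  by (simp add: amp_mat_def)

lemma amp_mat_mult_vec:
  assumes "v \<in> carrier_vec (N + 1)" "l \<le> N"
    and c: "\<And>k. k \<in> tri N \<Longrightarrow> c k = (\<Sum>l\<le>N. R k l * vec_index v l)"
  shows "vec_index (amp_mat N R *\<^sub>v v) l = final_coeff N c l"
proof -
  have "{0..<Suc N} = {..N}" by auto
  then have "vec_index (amp_mat N R *\<^sub>v v) l = (\<Sum>m\<le>N. (\<Sum>b\<le>N - l. R (l, b) m) * vec_index v m)"
    using assms(1,2) by (simp add: amp_mat_def scalar_prod_def)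
  also have "\<dots> = (\<Sum>b\<le>N - l. \<Sum>m\<le>N. R (l, b) m * vec_index v m)"
    unfolding sum_distrib_right by (rule sum.swap)
  also have "\<dots> = final_coeff N c l"
    unfolding final_coeff_def using assms(2) by (intro sum.cong refl c[symmetric]) (auto simp: tri_def)
  finally show ?thesis .
qed

text \<open>One direction reads the step off element \<open>i\<close>; the other builds a periodic
  Fourier mode on the whole grid from the data on that element.\<close>

lemma mode_step_iff:
  fixes \<kappa> :: nat
  assumes Ne: "Ne > 0" and dt: "dt > 0" and \<theta>: "\<theta> = real \<kappa> * mesh Ne" and i: "i \<in> {1..Ne}"
    and R: "is_solution_map N (dt / mesh Ne) (exp (- (\<i> * complex_of_real \<theta>))) R"
    and v: "v \<in> carrier_vec (N + 1)"
  shows "mode_step N Ne dt \<theta> n i v v' \<longleftrightarrow> v' = amp_mat N R *\<^sub>v v"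
proof
  let ?z = "exp (- (\<i> * complex_of_real \<theta>))"
  assume "mode_step N Ne dt \<theta> n i v v'"
  then obtain U c U' where step: "ader_dg_step N Ne dt n U c U'"
    and phase: "\<forall>j\<in>{1..Ne}. \<forall>l1 l2. l1 + l2 \<le> N \<longrightarrow>
      c (left_nb Ne j) l1 l2 = ?z * c j l1 l2"
    and U: "U i = v" "U' i = v'"
    unfolding mode_step_def by blast
  from step[unfolded ader_dg_step_iff[OF Ne dt R, where c = c, OF phase]] i U
  have v': "v' \<in> carrier_vec (N + 1)"
    and c: "\<And>l1 l2. l1 + l2 \<le> N \<Longrightarrow> c i l1 l2 = (\<Sum>l\<le>N. R (l1, l2) l * vec_index v l)"
    and fin: "\<And>l. l \<le> N \<Longrightarrow> vec_index v' l = final_coeff N (case_prod (c i)) l"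
    by auto
  have "vec_index v' l = vec_index (amp_mat N R *\<^sub>v v) l" if "l \<le> N" for l
    unfolding fin[OF that] by (rule amp_mat_mult_vec[OF v that, symmetric]) (auto simp: tri_def c)
  then show "v' = amp_mat N R *\<^sub>v v"
    using v' by (intro eq_vecI) (auto simp: amp_mat_def)
next
  let ?z = "exp (- (\<i> * complex_of_real \<theta>))"
  assume v': "v' = amp_mat N R *\<^sub>v v"
  \<comment> \<open>Phase of element \<open>j\<close> relative to element \<open>i\<close>, so that
    \<open>w i = 1\<close>.\<close>
  define w where "w j = exp (\<i> * complex_of_real (\<theta> * (real j - real i)))" for j
  have w: "w (left_nb Ne j) = ?z * w j" if "j \<in> {1..Ne}" for j
  proof (cases "j = 1")
    case True
    \<comment> \<open>All \<open>Ne\<close> cells together carry the phase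
      \<open>2 * pi * real \<kappa>\<close>. As \<open>\<kappa>\<close> is an integer, the mode
      closes up across the periodic boundary.\<close>
    have "\<theta> * real Ne = 2 * pi * real \<kappa>"
      using Ne by (simp add: \<theta> mesh_def)
    then have "\<theta> * (real Ne - real i) = 2 * pi * real \<kappa> - \<theta> * real i"
      by (simp add: algebra_simps)
    then have "w Ne = exp (\<i> * complex_of_real (2 * pi * real \<kappa>)) *
        exp (- (\<i> * complex_of_real (\<theta> * real i)))"
      unfolding w_def exp_add[symmetric] by (simp add: algebra_simps)
    also have "exp (\<i> * complex_of_real (2 * pi * real \<kappa>)) = 1"
      using exp_integer_2pi[of "of_nat \<kappa>"] by (simp add: mult_ac)
    also have "1 * exp (- (\<i> * complex_of_real (\<theta> * real i))) = ?z * w 1"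
      unfolding w_def exp_add[symmetric] by (simp add: algebra_simps)
    finally show ?thesis
      using True by (simp add: left_nb_def)
  next
    case False
    then show ?thesis
      using that unfolding w_def exp_add[symmetric] by (simp add: left_nb_def algebra_simps of_nat_diff)
  qed
  define U where "U j = w j \<cdot>\<^sub>v v" for j
  define U' where "U' j = w j \<cdot>\<^sub>v v'" for j
  define c where "c j l1 l2 = w j * (\<Sum>l\<le>N. R (l1, l2) l * vec_index v l)" for j l1 l2
  have w1: "w i = 1"
    by (simp add: w_def)
  have carrier: "v' \<in> carrier_vec (N + 1)"
    unfolding v' by (rule mult_mat_vec_carrier[OF amp_mat_carrier v])
  have phase: "\<forall>j\<in>{1..Ne}. \<forall>l1 l2. l1 + l2 \<le> N \<longrightarrow>
      c (left_nb Ne j) l1 l2 = ?z * c j l1 l2"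
    by (simp add: c_def w)
  have "ader_dg_step N Ne dt n U c U'"
    unfolding ader_dg_step_iff[OF Ne dt R, where c = c, OF phase]
  proof (intro ballI conjI allI impI)
    fix j l1 l2
    show "c j l1 l2 = (\<Sum>l\<le>N. R (l1, l2) l * vec_index (U j) l)"
      using v by (simp add: c_def U_def sum_distrib_left mult.left_commute)
  next
    fix j l assume l: "l \<le> N"
    have "vec_index v' l = final_coeff N (\<lambda>k. \<Sum>l\<le>N. R k l * vec_index v l) l"
      unfolding v' by (rule amp_mat_mult_vec[OF v l]) simp
    then show "vec_index (U' j) l = final_coeff N (case_prod (c j)) l"
      using carrier l by (simp add: U'_def final_coeff_def c_def sum_distrib_left)
  qed (use v carrier in \<open>simp_all add: U_def U'_def\<close>)
  then show "mode_step N Ne dt \<theta> n i v v'"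
    unfolding mode_step_def
    by (intro exI[of _ U] exI[of _ c] exI[of _ U'] conjI)
      (use phase in \<open>simp_all add: U_def U'_def w w1 smult_smult_assoc\<close>)
qed

text \<open>For an eigenvector the final trace is \<open>\<mu>\<close> times the datum. Dropping the
  two dissipation terms of the energy identity bounds its norm by that of the datum, which is not
  0.\<close>

lemma amp_mat_eigenvalue:
  assumes z: "cmod z = 1" and r: "r > 0"
    and R: "is_solution_map N r z R"
    and ev: "eigenvalue (amp_mat N R) \<mu>"
  shows "cmod \<mu> \<le> 1"
proof -
  obtain v where v: "v \<in> carrier_vec (N + 1)" "v \<noteq> 0\<^sub>v (N + 1)" "amp_mat N R *\<^sub>v v = \<mu> \<cdot>\<^sub>v v"
    using ev unfolding eigenvalue_def eigenvector_def by (auto simp: amp_mat_def)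
  let ?S = "ref_space N (vec_index v)"
  define c where "c k = (\<Sum>l\<le>N. R k l * vec_index v l)" for k
  have sol: "ref_form N r z d c = ref_load N d (vec_index v)" for d
    using R[unfolded is_solution_map_def, rule_format, of c "vec_index v"] by (simp add: c_def)
  have "final_coeff N c l = \<mu> * vec_index v l" if "l \<le> N" for l
    using amp_mat_mult_vec[OF v(1) that, of c R] v(1) that by (simp add: c_def v(3))
  then have "ref_poly N c x 1 = \<mu> * ?S x" for x
    unfolding ref_poly_1 by (simp add: ref_space_def sum_distrib_left mult.assoc)
  then have "sq_norm (-1/2) (1/2) (\<lambda>x. ref_poly N c x 1) = (cmod \<mu>)\<^sup>2 * sq_norm (-1/2) (1/2) ?S"
    by (simp add: sq_norm_def norm_mult power_mult_distrib)
  moreover have "r * sq_norm 0 1 (\<lambda>t. ref_poly N c (-1/2) t - z * ref_poly N c (1/2) t) \<ge> 0"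
    using r by (simp add: sq_norm_nonneg)
  moreover note energy_identity[OF z sol]
    sq_norm_nonneg[of "-1/2" "1/2" "\<lambda>x. ref_poly N c x 0 - ?S x"]
  ultimately have le: "(cmod \<mu>)\<^sup>2 * sq_norm (-1/2) (1/2) ?S \<le> sq_norm (-1/2) (1/2) ?S"
    by linarith
  have "sq_norm (-1/2) (1/2) ?S \<noteq> 0"
  proof
    assume n: "sq_norm (-1/2) (1/2) ?S = 0"
    have "?S x = 0" if "x \<in> {-1/2..1/2}" for x
      by (rule sq_norm_eq_0[OF _ _ n that])
        (use continuous_ref_space[OF continuous_on_id] in auto)
    then have "vec_index v l = 0" if "l \<le> N" for l
      by (intro polyfun_zero_on_interval[of "-1/2" "1/2" "vec_index v" N, OF _ _ that])
        (auto simp: ref_space_def)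
    with v(1) have "v = 0\<^sub>v (N + 1)"
      by (intro eq_vecI) auto
    with v(2) show False ..
  qed
  then have "sq_norm (-1/2) (1/2) ?S > 0"
    using sq_norm_nonneg by (metis less_eq_real_def)
  with le have "(cmod \<mu>)\<^sup>2 \<le> 1"
    by simp
  then show ?thesis
    by (simp add: power_le_one_iff abs_square_le_1)
qed

theorem theorem1:
  fixes N Ne \<kappa> :: nat and dx dt \<theta> :: real
  assumes "N \<ge> 1"
    and "Ne > 0"
    and "dx = 2 * pi / real Ne"
    and "\<theta> = real \<kappa> * dx"
    and "dt > 0"
  shows "(\<exists>!A. is_amplification_matrix N (dt / dx) \<theta> A) \<and>
    von_neumann_stable N (dt / dx) \<theta>"
proof -
  let ?z = "exp (- (\<i> * complex_of_real \<theta>))"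
  have dx: "dx = mesh Ne"
    using assms(3) by (simp add: mesh_def)
  have r: "dt / dx > 0"
    using assms(2,5) mesh_pos by (simp add: dx)
  have z: "cmod ?z = 1"
    by (simp add: norm_exp_eq_Re)
  obtain R where R: "is_solution_map N (dt / dx) ?z R"
    using ref_solution_map[OF z r] by blast
  let ?A = "amp_mat N R"
  \<comment> \<open>\<open>R\<close> comes from the ratio and the phase alone, so one matrix serves
    every grid, time level and element that share them.\<close>
  have A: "is_amplification_matrix N (dt / dx) \<theta> ?A"
    unfolding is_amplification_matrix_def
    using mode_step_iff R amp_mat_carrier by auto
  have unique: "B = ?A" if B: "is_amplification_matrix N (dt / dx) \<theta> B" for B
  proof -
    have "B *\<^sub>v v = ?A *\<^sub>v v" if v: "v \<in> carrier_vec (N + 1)" for v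
    proof -
      \<comment> \<open>The given grid, at time level 0 and element 1, is an instance of the
        quantified condition; hence both matrices give the same update of \<open>v\<close>.\<close>
      have "mode_step N Ne dt \<theta> 0 1 v v' \<longleftrightarrow> v' = M *\<^sub>v v"
        if "is_amplification_matrix N (dt / dx) \<theta> M" for M v'
        using that assms v unfolding is_amplification_matrix_def dx by simp
      from this[OF A] this[OF B] show ?thesis by blast
    qed
    moreover have "B \<in> carrier_mat (N + 1) (N + 1)"
      using B by (simp add: is_amplification_matrix_def)
    ultimately show ?thesis
      using mat_eqI_mult_vec amp_mat_carrier by blast
  qed
  have "amplification_matrix N (dt / dx) \<theta> = ?A"
    unfolding amplification_matrix_def using A unique by (rule the_equality)
  \<comment> \<open>The spectral radius is attained at an eigenvalue, so the eigenvalue bound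
    suffices.\<close>
  moreover obtain \<mu> where "\<mu> \<in> spectrum ?A" "spectral_radius ?A = cmod \<mu>"
    using spectral_radius_mem_max(1)[OF amp_mat_carrier, of N R] by auto
  ultimately have "von_neumann_stable N (dt / dx) \<theta>"
    using amp_mat_eigenvalue[OF z r R, of \<mu>] by (simp add: von_neumann_stable_def spectrum_def)
  with A unique show ?thesis by blast
qed

end
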